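(* Assume $(\diamondsuit^* )$. Then there is a locally countable, locally compact, $0$-dimensional $T_2$ space $X$ of cardinality $\omega_1$ such that $X$ is not linearly D, but every closed subspace $F\subseteq X$ is irreducible; equivalently, $X$ is an aD-space.
   Context: $(\diamondsuit^* )$: there is a sequence $\{\mathcal{A}_\alpha : \alpha<\omega_1 \text{ a limit ordinal}\}$ such that each $\mathcal{A}_\alpha$ is a countable family of subsets of $\alpha$, and for every $X\subseteq\omega_1$ there is a club $C\subseteq\omega_1$ with $X\cap\alpha\in\mathcal{A}_\alpha$ for all (limit) $\alpha\in C$. A space is locally countable if every point has a countable neighborhood; it is $0$-dimensional if it has a base of clopen sets. A subset of a space is closed discrete if it is closed and discrete in the subspace topology. An open neighborhood assignment (ONA) on $(X,\tau)$ is a map $U:X\to\tau$ with $x\in U(x)$ for all $x\in X$. $X$ is linearly D if for every ONA $U$ for which $\{U(x):x\in X\}$ is linearly ordered by inclusion there is a closed discrete $D\subseteq X$ with $X=\bigcup_{d\in D}U(d)$. $X$ is an aD-space if for every closed $F\subseteq X$ and every open cover $\mathcal{U}$ of $X$ there are a closed discrete set $A\subseteq F$ and a map $\phi:A\to\mathcal{U}$ with $a\in\phi(a)$ for all $a\in A$ such that $F\subseteq\bigcup\phi[A]$. A space $Y$ is irreducible if every open cover of $Y$ has a minimal open refinement, i.e. an open refinement $\mathcal{U}_0$ covering $Y$ such that no proper subfamily of $\mathcal{U}_0$ covers $Y$. For $T_1$-spaces $X$, it is known that $X$ is aD if and only if every closed subspace of $X$ is irreducible. *)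

theory Defs
  imports "HOL-Analysis.Analysis" "HOL-Library.Equipollence"
begin

unbundle cardinal_syntax

section \<open>The ordinal \<open>\<omega>\<^sub>1\<close>\<close>

text \<open>
  \<open>cardSuc natLeq\<close> is the cardinal successor of \<open>\<omega>\<close>, given as a well-order of minimal length.
  Its field is turned into a well-ordered type, in which the ordinal \<open>\<alpha>\<close> is identified, as a set of
  ordinals, with the initial segment \<open>{..<\<alpha>}\<close>.
\<close>

lemma Card_order_cardSuc_natLeq: "Card_order (cardSuc natLeq)"
  by (rule cardSuc_Card_order[OF natLeq_Card_order])

lemma Well_order_cardSuc_natLeq: "Well_order (cardSuc natLeq)"
  by (rule cardSuc_Well_order[OF natLeq_Card_order])

typedef omega1 = "Field (cardSuc natLeq)"
  using Field_cardSuc_not_empty[OF natLeq_Card_order] by blast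

instantiation omega1 :: wellorder
begin

definition less_eq_omega1 :: "omega1 \<Rightarrow> omega1 \<Rightarrow> bool" where
  "x \<le> y \<longleftrightarrow> (Rep_omega1 x, Rep_omega1 y) \<in> cardSuc natLeq"

definition less_omega1 :: "omega1 \<Rightarrow> omega1 \<Rightarrow> bool" where
  "x < y \<longleftrightarrow> x \<le> y \<and> x \<noteq> (y :: omega1)"

instance
proof
  let ?r = "cardSuc natLeq"
  have wo: "Well_order ?r" by (rule Well_order_cardSuc_natLeq)
  have rf: "refl_on (Field ?r) ?r" and tr: "trans ?r" and an: "antisym ?r"
    and tot: "total_on (Field ?r) ?r" and wf: "wf (?r - Id)"
    using wo by (auto simp: order_on_defs)
  fix x y z :: omega1
  show refl: "x \<le> x"
    using rf Rep_omega1[of x] by (auto simp: less_eq_omega1_def refl_on_def)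
  show "x \<le> z" if "x \<le> y" "y \<le> z"
    using that tr by (auto simp: less_eq_omega1_def dest: transD)
  show antisym: "x = y" if "x \<le> y" "y \<le> x"
    using that an by (auto simp: less_eq_omega1_def Rep_omega1_inject[symmetric] dest: antisymD)
  show "(x < y) = (x \<le> y \<and> \<not> y \<le> x)"
    using an rf Rep_omega1[of x]
    by (auto simp: less_omega1_def less_eq_omega1_def Rep_omega1_inject[symmetric] refl_on_def
        dest: antisymD)
  show "x \<le> y \<or> y \<le> x"
    using tot rf Rep_omega1[of x] Rep_omega1[of y]
    by (cases "x = y") (auto simp: less_eq_omega1_def Rep_omega1_inject[symmetric] refl_on_def
        total_on_def)
  show "P a" if step: "\<And>x. (\<And>y. y < x \<Longrightarrow> P y) \<Longrightarrow> P x" for P and a :: omega1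
  proof -
    have "wf (inv_image (?r - Id) Rep_omega1)"
      by (rule wf_inv_image[OF wf])
    then show "P a"
    proof (induction a rule: wf_induct_rule)
      case (less x)
      show ?case
        by (rule step, rule less.IH)
          (auto simp: inv_image_def less_omega1_def less_eq_omega1_def Rep_omega1_inject)
    qed
  qed
qed

end

lemma bij_betw_Rep_omega1: "bij_betw Rep_omega1 UNIV (Field (cardSuc natLeq))"
  using type_definition.Rep_range[OF type_definition_omega1]
  by (auto simp: bij_betw_def inj_on_def Rep_omega1_inject)

lemma card_of_omega1: "|UNIV :: omega1 set| =o cardSuc natLeq"
proof -
  have "|UNIV :: omega1 set| =o |Field (cardSuc natLeq)|"
    using bij_betw_Rep_omega1 card_of_ordIso by blast
  then show ?thesis
    using card_of_Field_ordIso[OF Card_order_cardSuc_natLeq] ordIso_transitive by blast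
qed

lemma uncountable_omega1: "uncountable (UNIV :: omega1 set)"
proof
  assume "countable (UNIV :: omega1 set)"
  then have "|UNIV :: omega1 set| \<le>o |UNIV :: nat set|"
    by (metis card_of_ordLeq countable_def subset_UNIV)
  then have "cardSuc natLeq \<le>o natLeq"
    by (meson card_of_nat card_of_omega1 ordIso_ordLeq_trans ordIso_symmetric ordLeq_ordIso_trans)
  then show False
    using cardSuc_greater[OF natLeq_Card_order] not_ordLess_ordLeq by blast
qed

lemma countable_lessThan_omega1: "countable {..<\<alpha> :: omega1}"
proof -
  let ?r = "cardSuc natLeq"
  have "|underS ?r (Rep_omega1 \<alpha>)| <o ?r"
    by (rule card_of_underS[OF Card_order_cardSuc_natLeq Rep_omega1])
  then have "|underS ?r (Rep_omega1 \<alpha>)| \<le>o natLeq"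
    by (simp add: cardSuc_ordLess_ordLeq card_of_Card_order natLeq_Card_order
        cardSuc_ordLeq_ordLess)
  then have "|underS ?r (Rep_omega1 \<alpha>)| \<le>o |UNIV :: nat set|"
    using card_of_nat ordIso_symmetric ordLeq_ordIso_trans by blast
  then have "countable (underS ?r (Rep_omega1 \<alpha>))"
    by (meson card_of_ordLeq countable_def)
  moreover have "Rep_omega1 ` {..<\<alpha>} \<subseteq> underS ?r (Rep_omega1 \<alpha>)"
    by (auto simp: underS_def less_omega1_def less_eq_omega1_def Rep_omega1_inject)
  ultimately have "countable (Rep_omega1 ` {..<\<alpha>})"
    by (rule countable_subset[rotated])
  then show ?thesis
    by (rule countable_image_inj_on) (simp add: inj_on_def Rep_omega1_inject)
qed

definition limit_ordinal :: "omega1 \<Rightarrow> bool" where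
  "limit_ordinal \<alpha> \<longleftrightarrow> (\<exists>\<beta>. \<beta> < \<alpha>) \<and> (\<forall>\<beta><\<alpha>. \<exists>\<gamma>. \<beta> < \<gamma> \<and> \<gamma> < \<alpha>)"

definition club :: "omega1 set \<Rightarrow> bool" where
  "club C \<longleftrightarrow>
     (\<forall>\<beta>. \<exists>\<gamma>\<in>C. \<beta> < \<gamma>) \<and>
     (\<forall>\<alpha>. limit_ordinal \<alpha> \<and> (\<forall>\<beta><\<alpha>. \<exists>\<gamma>\<in>C. \<beta> < \<gamma> \<and> \<gamma> < \<alpha>) \<longrightarrow> \<alpha> \<in> C)"

definition diamond_star :: bool where
  "diamond_star \<longleftrightarrow>
     (\<exists>\<A> :: omega1 \<Rightarrow> omega1 set set.
        (\<forall>\<alpha>. limit_ordinal \<alpha> \<longrightarrow> countable (\<A> \<alpha>) \<and> \<A> \<alpha> \<subseteq> Pow {..<\<alpha>}) \<and>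
        (\<forall>Y. \<exists>C. club C \<and> (\<forall>\<alpha>\<in>C. limit_ordinal \<alpha> \<longrightarrow> Y \<inter> {..<\<alpha>} \<in> \<A> \<alpha>)))"


section \<open>Topological notions\<close>

definition locally_countable_space :: "'a topology \<Rightarrow> bool" where
  "locally_countable_space X \<longleftrightarrow>
     (\<forall>x\<in>topspace X. \<exists>U N. openin X U \<and> x \<in> U \<and> U \<subseteq> N \<and> N \<subseteq> topspace X \<and> countable N)"

definition zero_dimensional_space :: "'a topology \<Rightarrow> bool" where
  "zero_dimensional_space X \<longleftrightarrow>
     (\<exists>\<B>. (\<forall>B\<in>\<B>. openin X B \<and> closedin X B) \<and>
          (\<forall>U x. openin X U \<and> x \<in> U \<longrightarrow> (\<exists>B\<in>\<B>. x \<in> B \<and> B \<subseteq> U)))"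

definition closed_discrete_in :: "'a topology \<Rightarrow> 'a set \<Rightarrow> bool" where
  "closed_discrete_in X D \<longleftrightarrow> closedin X D \<and> subtopology X D = discrete_topology D"

definition open_nbhd_assignment :: "'a topology \<Rightarrow> ('a \<Rightarrow> 'a set) \<Rightarrow> bool" where
  "open_nbhd_assignment X U \<longleftrightarrow> (\<forall>x\<in>topspace X. openin X (U x) \<and> x \<in> U x)"

definition linearly_D_space :: "'a topology \<Rightarrow> bool" where
  "linearly_D_space X \<longleftrightarrow>
     (\<forall>U. open_nbhd_assignment X U \<and> chain\<^sub>\<subseteq> (U ` topspace X) \<longrightarrow>
        (\<exists>D. closed_discrete_in X D \<and> topspace X = (\<Union>d\<in>D. U d)))"

definition open_cover_of :: "'a topology \<Rightarrow> 'a set set \<Rightarrow> bool" where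
  "open_cover_of X \<U> \<longleftrightarrow> (\<forall>U\<in>\<U>. openin X U) \<and> \<Union>\<U> = topspace X"

definition aD_space :: "'a topology \<Rightarrow> bool" where
  "aD_space X \<longleftrightarrow>
     (\<forall>F \<U>. closedin X F \<and> open_cover_of X \<U> \<longrightarrow>
        (\<exists>A \<phi>. A \<subseteq> F \<and> closed_discrete_in X A \<and>
               (\<forall>a\<in>A. \<phi> a \<in> \<U> \<and> a \<in> \<phi> a) \<and> F \<subseteq> \<Union>(\<phi> ` A)))"

definition irreducible_space :: "'a topology \<Rightarrow> bool" where
  "irreducible_space Y \<longleftrightarrow>
     (\<forall>\<U>. open_cover_of Y \<U> \<longrightarrow>
        (\<exists>\<U>\<^sub>0. open_cover_of Y \<U>\<^sub>0 \<and> (\<forall>V\<in>\<U>\<^sub>0. \<exists>U\<in>\<U>. V \<subseteq> U) \<and>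
              (\<forall>\<V>. \<V> \<subset> \<U>\<^sub>0 \<longrightarrow> \<Union>\<V> \<noteq> topspace Y)))"

end

theory Submission
  imports Defs
begin

text \<open>
  Points of \<open>\<omega>\<^sub>1\<close> are given a height \<open>h x\<close> such that every level of constant height is unbounded in
  \<open>\<omega>\<^sub>1\<close>. A point \<open>x\<close> of limit height \<open>\<gamma>\<close> is made the limit of those points \<open>p \<gamma> n\<close>, of heights
  increasing to \<open>\<gamma>\<close>, with \<open>n \<in> a x\<close>, where the sets \<open>a x\<close> are almost disjoint; all other points are
  isolated. The \<open>p \<gamma> n\<close> are taken from the sets guessed at \<open>\<gamma>\<close> by the diamond sequence in two ways: a
  guessed set \<open>Y\<close> contributes points of \<open>Y\<close>, and a guessed set \<open>Z\<close> of heights contributes points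
  \<open>z \<ge> \<gamma>\<close> with \<open>h z \<in> Z\<close>.

  By the first kind of guess, a closed set of unbounded height contains the whole level \<open>\<gamma>\<close> for club many
  \<open>\<gamma>\<close>, and every point of that level is one of its accumulation points. So closed discrete sets have
  bounded height, and the assignment \<open>x \<mapsto> {z. h z \<le> h x}\<close> refutes linear D. By the second kind of guess, a
  closed set \<open>F\<close> of unbounded height is also accumulated at height \<open>\<gamma>\<close> by points \<open>z \<in> F\<close> with
  \<open>h z < \<gamma> \<le> z\<close>; pressing down the heights of such \<open>z\<close> yields a subset of a single level, hence
  a closed discrete one, whose assigned cover elements leave only a part of \<open>F\<close> of bounded height
  uncovered. Closed sets of bounded height have the D-property, by induction on the bound.
\<close>

section \<open>Ordinals below \<open>\<omega>\<^sub>1\<close>\<close>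

text \<open>Otherwise the countable initial segments up to members of \<open>S\<close> would exhaust
  the uncountable \<open>omega1\<close>.\<close>

lemma countable_bounded_omega1:
  fixes S :: "omega1 set"
  assumes "countable S"
  obtains \<beta> where "\<And>x. x \<in> S \<Longrightarrow> x < \<beta>"
proof -
  have "\<exists>\<beta>. \<forall>x\<in>S. x < \<beta>"
  proof (rule ccontr)
    assume "\<nexists>\<beta>. \<forall>x\<in>S. x < \<beta>"
    then have "\<And>\<beta>. \<exists>x\<in>S. \<beta> \<le> x"
      by (meson not_le)
    then have "UNIV = (\<Union>x\<in>S. {..x})"
      by auto
    moreover have "countable {..x}" for x :: omega1
      by (simp add: countable_lessThan_omega1 flip: ivl_disj_un(2))
    ultimately show False
      using assms uncountable_omega1 by (metis countable_UN)
  qed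
  then show thesis
    using that by blast
qed

text \<open>The closure points of \<open>g\<close> form a club, and every club contains such a set.\<close>

definition closure_point :: "(omega1 \<Rightarrow> omega1) \<Rightarrow> omega1 \<Rightarrow> bool" where
  "closure_point g \<gamma> \<longleftrightarrow> limit_ordinal \<gamma> \<and> (\<forall>\<xi><\<gamma>. g \<xi> < \<gamma>)"

lemma closure_pointD:
  assumes "closure_point g \<gamma>"
  shows "limit_ordinal \<gamma>" "\<xi> < \<gamma> \<Longrightarrow> g \<xi> < \<gamma>"
  using assms by (auto simp: closure_point_def)

text \<open>Clubs are intersected by taking pointwise maxima of their functions: a closure point of
  the maximum is one of each argument.\<close>

lemma closure_point_mono:
  assumes g: "closure_point g \<gamma>" and le: "\<And>\<xi>. f \<xi> \<le> g \<xi>"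
  shows "closure_point f \<gamma>"
proof -
  have "f \<xi> < \<gamma>" if "\<xi> < \<gamma>" for \<xi>
    using le_less_trans[OF le closure_pointD(2)[OF g that]] .
  then show ?thesis
    using closure_pointD(1)[OF g] by (simp add: closure_point_def)
qed

text \<open>This yields diagonal intersections: a closure point of \<open>g\<close> is a closure
  point of \<open>G \<beta>\<close> for every smaller \<beta>, as
  \<open>g (max \<beta> \<xi>)\<close> exceeds \<open>G \<beta> \<xi>\<close>. Each value of
  \<open>g\<close> exists because it only has to bound countably many ordinals.\<close>

lemma common_bound_omega1:
  fixes G :: "omega1 \<Rightarrow> omega1 \<Rightarrow> omega1"
  obtains g where "\<And>\<beta> \<xi> \<gamma>. \<beta> \<le> \<gamma> \<Longrightarrow> \<xi> \<le> \<gamma> \<Longrightarrow> G \<beta> \<xi> < g \<gamma>"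
proof -
  have "\<exists>\<delta>. \<forall>\<beta> \<xi>. \<beta> \<le> \<gamma> \<longrightarrow> \<xi> \<le> \<gamma> \<longrightarrow> G \<beta> \<xi> < \<delta>" for \<gamma>
  proof -
    have "countable {..\<gamma>}"
      by (simp add: countable_lessThan_omega1 flip: ivl_disj_un(2))
    then have "countable (case_prod G ` ({..\<gamma>} \<times> {..\<gamma>}))"
      by blast
    then obtain \<delta> where "\<And>x. x \<in> case_prod G ` ({..\<gamma>} \<times> {..\<gamma>}) \<Longrightarrow> x < \<delta>"
      using countable_bounded_omega1 by blast
    then show ?thesis
      by (metis SigmaI atMost_iff case_prod_conv image_eqI)
  qed
  then show thesis
    using that by metis
qed

lemma exists_closure_point:
  obtains \<gamma> where "\<beta> < \<gamma>" "closure_point g \<gamma>"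
proof -
  \<comment> \<open>\<open>G\<close> exceeds its argument and all values of \<open>g\<close> up to
    there, so iterating it from \<beta> gives a strictly increasing sequence whose supremum is
    closed under \<open>g\<close>.\<close>
  obtain G where G: "\<And>\<beta> \<xi> \<gamma>. \<beta> \<le> \<gamma> \<Longrightarrow> \<xi> \<le> \<gamma> \<Longrightarrow> max \<beta> (g \<xi>) < G \<gamma>"
    using common_bound_omega1[of "\<lambda>\<beta> \<xi>. max \<beta> (g \<xi>)"] by blast
  define b where "b n = (G ^^ n) \<beta>" for n
  have b_Suc: "\<xi> \<le> b n \<Longrightarrow> g \<xi> < b (Suc n)" "b n < b (Suc n)" for n \<xi>
    using G[of "b n" "b n" \<xi>] G[of "b n" "b n" "b n"] by (auto simp: b_def)
  have "\<exists>u. \<forall>n. b n < u"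
    using countable_bounded_omega1[of "range b"] by (metis countableI_type countable_image rangeI)
  define \<gamma> where "\<gamma> = (LEAST u. \<forall>n. b n < u)"
  have b_less: "b n < \<gamma>" for n
    using LeastI_ex[OF \<open>\<exists>u. \<forall>n. b n < u\<close>] by (simp add: \<gamma>_def)
  have cof: "\<exists>n. \<xi> \<le> b n" if "\<xi> < \<gamma>" for \<xi>
    using not_less_Least[OF that[unfolded \<gamma>_def]] by (meson not_le)
  have "closure_point g \<gamma>"
    unfolding closure_point_def limit_ordinal_def
    by (meson b_Suc b_less cof le_less_trans less_trans)
  moreover have "\<beta> < \<gamma>"
    using b_less[of 0] by (simp add: b_def)
  ultimately show thesis
    using that by blast
qed

text \<open>A limit ordinal closed under a function that picks larger members of \<open>C\<close> is
  a limit of members of \<open>C\<close>.\<close>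

lemma club_closure_points:
  assumes "club C"
  obtains g where "\<And>\<gamma>. closure_point g \<gamma> \<Longrightarrow> \<gamma> \<in> C"
proof -
  obtain g where "\<And>\<beta>. g \<beta> \<in> C \<and> \<beta> < g \<beta>"
    using assms unfolding club_def by metis
  then have "\<gamma> \<in> C" if "closure_point g \<gamma>" for \<gamma>
    using assms that unfolding club_def closure_point_def by metis
  then show thesis
    using that by blast
qed

section \<open>Unbounded levels, almost disjoint sets and ladders\<close>

lemma exists_unbounded_fibers:
  obtains h :: "omega1 \<Rightarrow> omega1" where "\<And>\<beta> \<gamma>. \<exists>x\<ge>\<gamma>. h x = \<beta>"
proof -
  have "infinite (UNIV :: omega1 set)"
    using uncountable_omega1 countable_finite by blast
  then have "|(UNIV :: omega1 set) \<times> (UNIV :: omega1 set)| =o |UNIV :: omega1 set|"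
    by (rule card_of_Times_same_infinite)
  then obtain f :: "omega1 \<times> omega1 \<Rightarrow> omega1" where f: "bij f"
    using card_of_ordIso by fastforce
  \<comment> \<open>The height is the first coordinate under the bijection with pairs; a bounded
    fibre would be countable.\<close>
  have "\<exists>x\<ge>\<gamma>. fst (inv f x) = \<beta>" for \<beta> \<gamma>
  proof (rule ccontr)
    assume neg: "\<nexists>x. \<gamma> \<le> x \<and> fst (inv f x) = \<beta>"
    have "f (\<beta>, y) < \<gamma>" for y
    proof (rule ccontr)
      assume "\<not> f (\<beta>, y) < \<gamma>"
      with neg f show False
        by (metis bij_inv_eq_iff fst_conv not_le)
    qed
    then have "range (\<lambda>y. f (\<beta>, y)) \<subseteq> {..<\<gamma>}"
      by auto
    then have "countable (range (\<lambda>y. f (\<beta>, y)))"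
      using countable_lessThan_omega1 countable_subset by blast
    moreover have "inj (\<lambda>y. f (\<beta>, y))"
      by (rule injI) (use bij_is_inj[OF f] in \<open>auto dest: injD\<close>)
    ultimately show False
      using uncountable_omega1 countable_image_inj_on by blast
  qed
  then show thesis
    using that[of "\<lambda>x. fst (inv f x)"] by blast
qed

text \<open>\<open>cardSuc natLeq\<close> is the least cardinal above \<omega>, and by Cantor's
  theorem the power set of the naturals is above \<omega>.\<close>

lemma exists_inj_omega1_reals: "\<exists>r :: omega1 \<Rightarrow> nat \<Rightarrow> bool. inj r"
proof -
  have "natLeq <o |Pow (UNIV :: nat set)|"
    using card_of_Pow[of "UNIV :: nat set"] card_of_nat ordIso_ordLess_trans ordIso_symmetric
    by blast
  then have "cardSuc natLeq \<le>o |Pow (UNIV :: nat set)|"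
    by (simp add: cardSuc_least card_of_Card_order natLeq_Card_order)
  then have "|UNIV :: omega1 set| \<le>o |UNIV :: nat set set|"
    using card_of_omega1 ordIso_ordLeq_trans by fastforce
  then obtain f :: "omega1 \<Rightarrow> nat set" where "inj f"
    by (metis card_of_ordLeq)
  then have "inj (\<lambda>x n. n \<in> f x)"
    by (auto simp: inj_def fun_eq_iff)
  then show ?thesis
    by blast
qed

text \<open>The sets come from branches of the binary tree: distinct branches share only finitely
  many initial segments. The extra coordinate \<open>i\<close> splits each set into infinitely many
  infinite columns, so that every member of a countable family can recur infinitely often along
  every \<open>a x\<close>.\<close>

lemma exists_almost_disjoint_family:
  obtains a :: "omega1 \<Rightarrow> nat set" where
    "\<And>x y. x \<noteq> y \<Longrightarrow> finite (a x \<inter> a y)"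
    "\<And>x i. infinite {n \<in> a x. fst (prod_decode n) = i}"
proof -
  obtain r :: "omega1 \<Rightarrow> nat \<Rightarrow> bool" where r: "inj r"
    using exists_inj_omega1_reals by blast
  define c where "c x j = to_nat (map (r x) [0..<j])" for x j
  have c_eq: "j = k \<and> (\<forall>m<j. r x m = r y m)" if eq: "c x j = c y k" for x y j k
  proof -
    have "map (r x) [0..<j] = map (r y) [0..<k]"
      using eq by (simp add: c_def)
    then show ?thesis
      by (metis diff_zero length_map length_upt map_eq_conv atLeastLessThan_iff set_upt
          zero_le)
  qed
  \<comment> \<open>The restriction \<open>i \<le> j\<close> leaves finitely many codes for each
    initial segment, so the extra coordinate does not spoil almost disjointness.\<close>
  define a where "a x = {prod_encode (i, c x j) | i j. i \<le> j}" for x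
  have "finite (a x \<inter> a y)" if "x \<noteq> y" for x y
  proof -
    obtain m where m: "r x m \<noteq> r y m"
      using \<open>x \<noteq> y\<close> r by (auto simp: inj_def fun_eq_iff)
    have "a x \<inter> a y \<subseteq> (\<lambda>(i, j). prod_encode (i, c x j)) ` ({..m} \<times> {..m})"
    proof
      fix n
      assume "n \<in> a x \<inter> a y"
      then obtain i j k where n: "n = prod_encode (i, c x j)" "i \<le> j" "c x j = c y k"
        by (auto simp: a_def)
      then have "j \<le> m"
        using c_eq m not_le by blast
      with n have "n = (\<lambda>(i, j). prod_encode (i, c x j)) (i, j)" "(i, j) \<in> {..m} \<times> {..m}"
        by auto
      then show "n \<in> (\<lambda>(i, j). prod_encode (i, c x j)) ` ({..m} \<times> {..m})"
        by (rule image_eqI)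
    qed
    then show ?thesis
      by (rule finite_subset) auto
  qed
  moreover have "infinite {n \<in> a x. fst (prod_decode n) = i}" for x i
  proof -
    have "(\<lambda>j. prod_encode (i, c x j)) ` {i..} \<subseteq> {n \<in> a x. fst (prod_decode n) = i}"
      by (auto simp: a_def)
    moreover have "inj_on (\<lambda>j. prod_encode (i, c x j)) {i..}"
      using c_eq by (fastforce simp: inj_on_def)
    ultimately show ?thesis
      using infinite_Ici finite_imageD finite_subset by blast
  qed
  ultimately show thesis
    using that by blast
qed

text \<open>The points are chosen one after another, with \<open>l n\<close> at or above both the
  previous height and the n-th term of an enumeration of the ordinals below \<gamma>; the latter
  makes \<open>l\<close> cofinal.\<close>

lemma exists_ladder:
  fixes P :: "nat \<Rightarrow> omega1 set" and h :: "omega1 \<Rightarrow> omega1"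
  assumes lim: "limit_ordinal \<gamma>"
    and P: "\<And>n \<beta>. \<beta> < \<gamma> \<Longrightarrow> \<exists>x\<in>P n. \<beta> < h x \<and> h x < \<gamma>"
  obtains l p where "\<And>n. p n \<in> P n" "\<And>n. l n < h (p n)" "\<And>n. h (p n) \<le> l (Suc n)"
    "\<And>n. h (p n) < \<gamma>" "\<And>\<beta>. \<beta> < \<gamma> \<Longrightarrow> \<exists>n. \<beta> \<le> l n"
proof -
  have ne: "{..<\<gamma>} \<noteq> {}"
    using lim by (auto simp: limit_ordinal_def)
  define e where "e = from_nat_into {..<\<gamma>}"
  have e_less: "e n < \<gamma>" for n
    using from_nat_into[OF ne] by (simp add: e_def)
  have e_surj: "\<exists>n. e n = \<beta>" if "\<beta> < \<gamma>" for \<beta>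
    using from_nat_into_surj[OF countable_lessThan_omega1] that by (auto simp: e_def)
  \<comment> \<open>A state \<open>s\<close> pairs the lower bound \<open>l n\<close> with the point
    \<open>p n\<close>.\<close>
  define Q where "Q n s \<longleftrightarrow> snd s \<in> P n \<and> fst s < h (snd s) \<and> h (snd s) < \<gamma> \<and> e n \<le> fst s"
    for n and s :: "omega1 \<times> omega1"
  have step: "\<exists>t. Q n t \<and> \<beta> \<le> fst t" if "\<beta> < \<gamma>" for n \<beta>
  proof -
    obtain x where "x \<in> P n" "max \<beta> (e n) < h x" "h x < \<gamma>"
      using P[of "max \<beta> (e n)" n] \<open>\<beta> < \<gamma>\<close> e_less by auto
    then show ?thesis
      by (intro exI[of _ "(max \<beta> (e n), x)"]) (auto simp: Q_def)
  qed
  obtain s where s: "\<And>n. Q n (s n)" "\<And>n. h (snd (s n)) \<le> fst (s (Suc n))"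
    using dependent_nat_choice[of Q "\<lambda>n s t. h (snd s) \<le> fst t"] step e_less
    unfolding Q_def by (metis (no_types, lifting))
  show thesis
  proof (rule that[of "\<lambda>n. snd (s n)" "\<lambda>n. fst (s n)"])
    show "\<exists>n. \<beta> \<le> fst (s n)" if "\<beta> < \<gamma>" for \<beta>
      using e_surj[OF that] s(1) unfolding Q_def by metis
  qed (use s in \<open>auto simp: Q_def\<close>)
qed

section \<open>Closed discrete sets\<close>

text \<open>This reduces closedness and discreteness to one local condition, which passes to subsets
  and to locally finite unions.\<close>

lemma closed_discrete_in_iff:
  "closed_discrete_in X D \<longleftrightarrow>
     D \<subseteq> topspace X \<and> (\<forall>x\<in>topspace X. \<exists>W. openin X W \<and> x \<in> W \<and> W \<inter> D \<subseteq> {x})"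
proof safe
  fix x
  assume D: "closed_discrete_in X D" and x: "x \<in> topspace X"
  show "\<exists>W. openin X W \<and> x \<in> W \<and> W \<inter> D \<subseteq> {x}"
  proof (cases "x \<in> D")
    case True
    then have "openin (subtopology X D) {x}"
      using D by (simp add: closed_discrete_in_def)
    then show ?thesis
      by (auto simp: openin_subtopology)
  next
    case False
    then show ?thesis
      using D x by (intro exI[of _ "topspace X - D"]) (auto simp: closed_discrete_in_def)
  qed
next
  fix x
  assume "closed_discrete_in X D" "x \<in> D"
  then show "x \<in> topspace X"
    using closedin_subset by (auto simp: closed_discrete_in_def)
next
  assume D: "D \<subseteq> topspace X"
    and W: "\<forall>x\<in>topspace X. \<exists>W. openin X W \<and> x \<in> W \<and> W \<inter> D \<subseteq> {x}"
  have "openin X (topspace X - D)"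
    unfolding openin_subopen[of X "topspace X - D"]
  proof
    fix x
    assume x: "x \<in> topspace X - D"
    then obtain V where "openin X V" "x \<in> V" "V \<inter> D \<subseteq> {x}"
      using W by blast
    then show "\<exists>T. openin X T \<and> x \<in> T \<and> T \<subseteq> topspace X - D"
      using x openin_subset by blast
  qed
  then have "closedin X D"
    using D by (simp add: closedin_def)
  moreover have "subtopology X D = discrete_topology D"
  proof -
    have "openin (subtopology X D) {x}" if "x \<in> D" for x
    proof -
      obtain W' where "openin X W'" "x \<in> W'" "W' \<inter> D \<subseteq> {x}"
        using W subsetD[OF D \<open>x \<in> D\<close>] by meson
      then have "openin X W'" "{x} = W' \<inter> D"
        using that by auto
      then show ?thesis
        unfolding openin_subtopology by blast
    qed
    then show ?thesis
      using D by (metis discrete_topology_unique topspace_subtopology_subset)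
  qed
  ultimately show "closed_discrete_in X D"
    by (simp add: closed_discrete_in_def)
qed

lemma closed_discrete_in_subset:
  assumes "closed_discrete_in X D" "E \<subseteq> D"
  shows "closed_discrete_in X E"
proof -
  have "\<exists>W. openin X W \<and> x \<in> W \<and> W \<inter> E \<subseteq> {x}" if "x \<in> topspace X" for x
  proof -
    obtain W where "openin X W" "x \<in> W" "W \<inter> D \<subseteq> {x}"
      using assms(1) \<open>x \<in> topspace X\<close> unfolding closed_discrete_in_iff by meson
    then show ?thesis
      using \<open>E \<subseteq> D\<close> by blast
  qed
  then show ?thesis
    using assms unfolding closed_discrete_in_iff by blast
qed

lemma closed_discrete_in_Union:
  assumes cd: "\<And>i. i \<in> I \<Longrightarrow> closed_discrete_in X (D i)"
    and loc: "\<And>x. x \<in> topspace X \<Longrightarrow> \<exists>W. openin X W \<and> x \<in> W \<and> finite {i \<in> I. D i \<inter> W \<noteq> {}}"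
  shows "closed_discrete_in X (\<Union>i\<in>I. D i)"
  unfolding closed_discrete_in_iff
proof (intro conjI ballI)
  show "(\<Union>i\<in>I. D i) \<subseteq> topspace X"
    using cd unfolding closed_discrete_in_iff by blast
next
  fix x
  assume x: "x \<in> topspace X"
  obtain W where W: "openin X W" "x \<in> W" "finite {i \<in> I. D i \<inter> W \<noteq> {}}"
    using loc[OF x] by blast
  have "\<forall>i\<in>I. \<exists>V. openin X V \<and> x \<in> V \<and> V \<inter> D i \<subseteq> {x}"
    using cd x unfolding closed_discrete_in_iff by blast
  then obtain V where V: "\<And>i. i \<in> I \<Longrightarrow> openin X (V i) \<and> x \<in> V i \<and> V i \<inter> D i \<subseteq> {x}"
    by metis
  \<comment> \<open>Inside \<open>W\<close> only finitely many \<open>D i\<close> matter; inserting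
    \<open>W\<close> keeps the intersected family nonempty.\<close>
  let ?T = "W \<inter> \<Inter> (insert W (V ` {i \<in> I. D i \<inter> W \<noteq> {}}))"
  have "openin X ?T"
    using W V by (intro openin_Int openin_Inter) auto
  moreover have "x \<in> ?T" "?T \<inter> (\<Union>i\<in>I. D i) \<subseteq> {x}"
    using W V by blast+
  ultimately show "\<exists>W. openin X W \<and> x \<in> W \<and> W \<inter> (\<Union>i\<in>I. D i) \<subseteq> {x}"
    by blast
qed

lemma closed_discrete_in_Un:
  assumes "closed_discrete_in X D" "closed_discrete_in X E"
  shows "closed_discrete_in X (D \<union> E)"
proof -
  have "closed_discrete_in X (\<Union>A\<in>{D, E}. A)"
    by (rule closed_discrete_in_Union) (use assms in auto)
  then show ?thesis
    by simp
qed

text \<open>The closed discrete set given by the aD-property leads to a minimal cover: from each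
  chosen open set all other points of the set are removed, so each member is the only one containing
  its own point.\<close>

lemma irreducible_closed_subspace:
  assumes aD: "aD_space X" and F: "closedin X F"
  shows "irreducible_space (subtopology X F)"
  unfolding irreducible_space_def
proof (intro allI impI)
  fix \<U>
  assume \<U>: "open_cover_of (subtopology X F) \<U>"
  have top: "topspace (subtopology X F) = F"
    using closedin_subset[OF F] by auto
  \<comment> \<open>The complement of \<open>F\<close> completes the lifted sets to a cover of
    \<open>X\<close>. It is never a value of \<open>\<phi>\<close>, since \<open>\<phi> a\<close>
    contains a point \<open>a\<close> of \<open>F\<close>.\<close>
  define \<U>' where "\<U>' = insert (topspace X - F) {U. openin X U \<and> U \<inter> F \<in> \<U>}"
  have "F \<subseteq> \<Union>\<U>'"
  proof
    fix x
    assume "x \<in> F"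
    then obtain U where U: "U \<in> \<U>" "x \<in> U"
      using \<U> top unfolding open_cover_of_def by blast
    then obtain T where "openin X T" "U = T \<inter> F"
      using \<U> unfolding open_cover_of_def openin_subtopology by blast
    then show "x \<in> \<Union>\<U>'"
      using U by (auto simp: \<U>'_def)
  qed
  moreover have "\<forall>U\<in>\<U>'. openin X U"
    using F by (auto simp: \<U>'_def)
  moreover have "U \<subseteq> topspace X" if "U \<in> \<U>'" for U
    using that openin_subset[of X U] by (auto simp: \<U>'_def)
  moreover have "topspace X - F \<in> \<U>'"
    by (simp add: \<U>'_def)
  ultimately have "open_cover_of X \<U>'"
    unfolding open_cover_of_def by blast
  then obtain A \<phi> where A: "A \<subseteq> F" "closed_discrete_in X A"
    and \<phi>: "\<And>a. a \<in> A \<Longrightarrow> \<phi> a \<in> \<U>' \<and> a \<in> \<phi> a" and cov: "F \<subseteq> \<Union>(\<phi> ` A)"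
    using aD F unfolding aD_space_def by metis
  have \<phi>': "openin X (\<phi> a)" "\<phi> a \<inter> F \<in> \<U>" if "a \<in> A" for a
    using \<phi>[OF that] A(1) that by (auto simp: \<U>'_def)
  \<comment> \<open>\<open>A - {a}\<close> is closed, so \<open>W a\<close> is open in
    \<open>F\<close>. Points outside \<open>A\<close> stay covered as before, and each point of
    \<open>A\<close> by its own \<open>W a\<close>.\<close>
  define W where "W a = (\<phi> a - (A - {a})) \<inter> F" for a
  have W_open: "openin (subtopology X F) (W a)" if "a \<in> A" for a
  proof -
    have "closedin X (A - {a})"
      using closed_discrete_in_subset[OF A(2)] unfolding closed_discrete_in_def by blast
    then show ?thesis
      using \<phi>'(1)[OF that] unfolding W_def openin_subtopology by blast
  qed
  have W_iff: "b \<in> W a \<longleftrightarrow> a = b" if "a \<in> A" "b \<in> A" for a b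
    using that \<phi> A(1) by (auto simp: W_def)
  have W_cov: "\<Union>(W ` A) = F"
  proof
    show "F \<subseteq> \<Union>(W ` A)"
    proof
      fix x
      assume x: "x \<in> F"
      show "x \<in> \<Union>(W ` A)"
      proof (cases "x \<in> A")
        case True
        then show ?thesis
          using W_iff by blast
      next
        case False
        then show ?thesis
          using cov x by (auto simp: W_def)
      qed
    qed
  qed (auto simp: W_def)
  show "\<exists>\<U>\<^sub>0. open_cover_of (subtopology X F) \<U>\<^sub>0 \<and> (\<forall>V\<in>\<U>\<^sub>0. \<exists>U\<in>\<U>. V \<subseteq> U) \<and>
      (\<forall>\<V>. \<V> \<subset> \<U>\<^sub>0 \<longrightarrow> \<Union>\<V> \<noteq> topspace (subtopology X F))"
  proof (intro exI[of _ "W ` A"] conjI allI impI ballI)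
    show "open_cover_of (subtopology X F) (W ` A)"
      using W_open W_cov top by (auto simp: open_cover_of_def)
    show "\<exists>U\<in>\<U>. V \<subseteq> U" if V: "V \<in> W ` A" for V
      using V \<phi>'(2) by (auto simp: W_def)
    show "\<Union>\<V> \<noteq> topspace (subtopology X F)" if V: "\<V> \<subset> W ` A" for \<V>
    proof -
      obtain a where a: "a \<in> A" "W a \<notin> \<V>"
        using V by blast
      then have "a \<notin> \<Union>\<V>"
        using V W_iff by blast
      then show ?thesis
        using a A(1) top by blast
    qed
  qed
qed

section \<open>Spaces from ladders\<close>

text \<open>For a limit \<gamma>, the height intervals from \<open>l \<gamma> n\<close> (exclusive)
  to \<open>h (p \<gamma> n)\<close> (inclusive) are pairwise disjoint and converge to \<gamma>.
  Blocks, the neighbourhoods of ladder points with heights in these intervals, are thus disjoint for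
  different indices; almost disjointness takes care of shared indices.\<close>

locale ladder_space =
  fixes h :: "omega1 \<Rightarrow> omega1" and a :: "omega1 \<Rightarrow> nat set" and l p :: "omega1 \<Rightarrow> nat \<Rightarrow> omega1"
  assumes almost_disjoint: "x \<noteq> y \<Longrightarrow> finite (a x \<inter> a y)"
    and l_less: "limit_ordinal \<gamma> \<Longrightarrow> l \<gamma> n < h (p \<gamma> n)"
    and h_le_l: "limit_ordinal \<gamma> \<Longrightarrow> h (p \<gamma> n) \<le> l \<gamma> (Suc n)"
    and h_less: "limit_ordinal \<gamma> \<Longrightarrow> h (p \<gamma> n) < \<gamma>"
    and l_cofinal: "limit_ordinal \<gamma> \<Longrightarrow> \<beta> < \<gamma> \<Longrightarrow> \<exists>n. \<beta> \<le> l \<gamma> n"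
begin

text \<open>
  \<open>in_nbhd x \<beta>\<close> is a neighbourhood of \<open>x\<close> with heights in the interval from \<open>\<beta>\<close> (exclusive) to \<open>h x\<close>,
  provided that \<open>\<beta> < h x\<close>. For \<open>h x\<close> a limit and \<open>\<beta> \<ge> h x\<close> it is the non-open set \<open>{x}\<close>.
\<close>

inductive in_nbhd :: "omega1 \<Rightarrow> omega1 \<Rightarrow> omega1 \<Rightarrow> bool" where
  in_nbhd_self: "in_nbhd x \<beta> x"
| in_nbhd_step: "limit_ordinal (h x) \<Longrightarrow> n \<in> a x \<Longrightarrow> \<beta> \<le> l (h x) n \<Longrightarrow>
    in_nbhd (p (h x) n) (l (h x) n) z \<Longrightarrow> in_nbhd x \<beta> z"

definition nbhd :: "omega1 \<Rightarrow> omega1 \<Rightarrow> omega1 set" where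
  "nbhd x \<beta> = {z. in_nbhd x \<beta> z}"

lemma nbhd_self: "x \<in> nbhd x \<beta>"
  by (simp add: nbhd_def in_nbhd_self)

lemma nbhd_step:
  assumes "limit_ordinal (h x)" "n \<in> a x" "\<beta> \<le> l (h x) n"
  shows "nbhd (p (h x) n) (l (h x) n) \<subseteq> nbhd x \<beta>"
  using assms by (auto simp: nbhd_def intro: in_nbhd_step)

lemma nbhd_cases:
  assumes "z \<in> nbhd x \<beta>"
  obtains "z = x"
  | n where "limit_ordinal (h x)" "n \<in> a x" "\<beta> \<le> l (h x) n" "z \<in> nbhd (p (h x) n) (l (h x) n)"
  using assms unfolding nbhd_def mem_Collect_eq by (cases rule: in_nbhd.cases) auto

lemma nbhd_antimono: "\<beta> \<le> \<gamma> \<Longrightarrow> nbhd x \<gamma> \<subseteq> nbhd x \<beta>"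
proof
  fix z
  assume le: "\<beta> \<le> \<gamma>" and "z \<in> nbhd x \<gamma>"
  from this(2) show "z \<in> nbhd x \<beta>"
  proof (cases rule: nbhd_cases)
    case 1
    then show ?thesis
      by (simp add: nbhd_self)
  next
    case (2 n)
    then show ?thesis
      using nbhd_step[of x n \<beta>] order_trans[OF le] by blast
  qed
qed

lemma nbhd_nonlimit: "\<not> limit_ordinal (h x) \<Longrightarrow> nbhd x \<beta> = {x}"
  using nbhd_cases[of _ x \<beta>] nbhd_self by blast

text \<open>Every step goes to a point of smaller height and to a bound that is at least
  \<beta>.\<close>

lemma in_nbhd_height: "in_nbhd x \<beta> z \<Longrightarrow> z = x \<or> \<beta> < h z \<and> h z < h x"
proof (induction rule: in_nbhd.induct)
  case (in_nbhd_step x n \<beta> z)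
  have "l (h x) n < h z" "h z \<le> h (p (h x) n)"
    using in_nbhd_step.IH l_less[OF in_nbhd_step.hyps(1), of n] by auto
  then show ?case
    using h_less[OF in_nbhd_step.hyps(1), of n] in_nbhd_step.hyps(3) by auto
qed auto

lemma nbhd_height: "z \<in> nbhd x \<beta> \<Longrightarrow> z = x \<or> \<beta> < h z \<and> h z < h x"
  using in_nbhd_height by (simp add: nbhd_def)

text \<open>This is what makes \<open>nbhd x \<beta>\<close> open: an element other than
  \<open>x\<close> lies in a block, whose bound is below the height of its top by
  \<open>l_less\<close>, so the induction continues there.\<close>

lemma in_nbhd_nbhd_subset:
  assumes "in_nbhd x \<beta> z" "limit_ordinal (h x) \<longrightarrow> \<beta> < h x" "limit_ordinal (h z)"
  shows "\<exists>\<beta>'<h z. nbhd z \<beta>' \<subseteq> nbhd x \<beta>"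
  using assms
proof (induction rule: in_nbhd.induct)
  case (in_nbhd_step x n \<beta> z)
  then show ?case
    using l_less[OF in_nbhd_step.hyps(1), of n] nbhd_step[of x n \<beta>] by blast
qed auto

lemma l_mono: "limit_ordinal \<gamma> \<Longrightarrow> m \<le> n \<Longrightarrow> l \<gamma> m \<le> l \<gamma> n"
  by (rule lift_Suc_mono_le[of "l \<gamma>"])
    (use order_trans[OF less_imp_le[OF l_less] h_le_l] in auto)

lemma h_le_l': "limit_ordinal \<gamma> \<Longrightarrow> m < n \<Longrightarrow> h (p \<gamma> m) \<le> l \<gamma> n"
  using h_le_l[of \<gamma> m] l_mono[of \<gamma> "Suc m" n] by (meson Suc_leI order_trans)

lemma finite_l_less:
  assumes "limit_ordinal \<gamma>" "\<beta> < \<gamma>"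
  shows "finite {n. l \<gamma> n < \<beta>}"
proof -
  obtain m where m: "\<beta> \<le> l \<gamma> m"
    using l_cofinal assms by blast
  have "{n. l \<gamma> n < \<beta>} \<subseteq> {..<m}"
  proof
    fix n
    assume "n \<in> {n. l \<gamma> n < \<beta>}"
    then have "l \<gamma> n < l \<gamma> m"
      using m by simp
    then have "\<not> m \<le> n"
      using l_mono[OF assms(1), of m n] by auto
    then show "n \<in> {..<m}"
      by simp
  qed
  then show ?thesis
    by (rule finite_subset) simp
qed

lemma infinite_l_ge:
  assumes "limit_ordinal \<gamma>" "\<beta> < \<gamma>" "infinite M"
  obtains n where "n \<in> M" "\<beta> \<le> l \<gamma> n"
proof -
  have "infinite (M - {n. l \<gamma> n < \<beta>})"
    using finite_l_less[OF assms(1,2)] assms(3) by simp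
  then obtain n where "n \<in> M - {n. l \<gamma> n < \<beta>}"
    using infinite_imp_nonempty by blast
  then show thesis
    using that by auto
qed

section \<open>The topology and its separation properties\<close>

definition space :: "omega1 topology" where
  "space = topology (\<lambda>U. \<forall>x\<in>U. limit_ordinal (h x) \<longrightarrow> (\<exists>\<beta><h x. nbhd x \<beta> \<subseteq> U))"

lemma openin_space:
  "openin space U \<longleftrightarrow> (\<forall>x\<in>U. limit_ordinal (h x) \<longrightarrow> (\<exists>\<beta><h x. nbhd x \<beta> \<subseteq> U))"
proof -
  let ?P = "\<lambda>U. \<forall>x\<in>U. limit_ordinal (h x) \<longrightarrow> (\<exists>\<beta><h x. nbhd x \<beta> \<subseteq> U)"
  have "istopology ?P"
    unfolding istopology_def
  proof (intro conjI allI impI ballI)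
    fix S T x
    assume S: "?P S" and T: "?P T" and x: "x \<in> S \<inter> T" and lim: "limit_ordinal (h x)"
    obtain \<beta> where \<beta>: "\<beta> < h x" "nbhd x \<beta> \<subseteq> S"
      using S x lim by blast
    obtain \<gamma> where \<gamma>: "\<gamma> < h x" "nbhd x \<gamma> \<subseteq> T"
      using T x lim by blast
    have "nbhd x (max \<beta> \<gamma>) \<subseteq> S \<inter> T"
      using \<beta>(2) \<gamma>(2) nbhd_antimono[of \<beta> "max \<beta> \<gamma>" x] nbhd_antimono[of \<gamma> "max \<beta> \<gamma>" x] by auto
    then show "\<exists>\<beta><h x. nbhd x \<beta> \<subseteq> S \<inter> T"
      using \<beta>(1) \<gamma>(1) by (intro exI[of _ "max \<beta> \<gamma>"]) auto
  next
    fix \<K> x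
    assume K: "\<forall>K\<in>\<K>. ?P K" and x: "x \<in> \<Union>\<K>" and lim: "limit_ordinal (h x)"
    obtain K where "K \<in> \<K>" "x \<in> K"
      using x by blast
    then show "\<exists>\<beta><h x. nbhd x \<beta> \<subseteq> \<Union>\<K>"
      using K lim by (meson Union_upper order_trans)
  qed
  then show ?thesis
    by (simp add: space_def topology_inverse')
qed

lemma topspace_space [simp]: "topspace space = UNIV"
proof -
  have "openin space UNIV"
    using limit_ordinal_def by (auto simp: openin_space)
  then show ?thesis
    using openin_subset by blast
qed

lemma openin_nbhd:
  assumes "limit_ordinal (h x) \<longrightarrow> \<beta> < h x"
  shows "openin space (nbhd x \<beta>)"
  unfolding openin_space using in_nbhd_nbhd_subset[OF _ assms] by (simp add: nbhd_def)

lemma open_nbhdE: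
  assumes "openin space U" "x \<in> U"
  obtains \<beta> where "limit_ordinal (h x) \<longrightarrow> \<beta> < h x" "nbhd x \<beta> \<subseteq> U"
proof (cases "limit_ordinal (h x)")
  case True
  then obtain \<beta> where "\<beta> < h x" "nbhd x \<beta> \<subseteq> U"
    using assms unfolding openin_space by meson
  then show thesis
    using that by blast
next
  case False
  then show thesis
    using that[of x] nbhd_nonlimit[of x x] assms(2) by auto
qed

text \<open>Basic neighbourhoods only extend downwards in height. Together with
  \<open>openin_height_greaterThan\<close> this says that \<open>h\<close> is continuous for the
  order topology.\<close>

lemma openin_height_atMost: "openin space {x. h x \<le> \<beta>}"
  unfolding openin_space
proof (intro ballI impI)
  fix x
  assume x: "x \<in> {x. h x \<le> \<beta>}" and lim: "limit_ordinal (h x)"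
  obtain \<gamma> where "\<gamma> < h x"
    using lim by (auto simp: limit_ordinal_def)
  moreover have "nbhd x \<gamma> \<subseteq> {x. h x \<le> \<beta>}"
    using nbhd_height[of _ x \<gamma>] x by force
  ultimately show "\<exists>\<gamma><h x. nbhd x \<gamma> \<subseteq> {x. h x \<le> \<beta>}"
    by blast
qed

lemma openin_height_greaterThan: "openin space {x. \<beta> < h x}"
  unfolding openin_space
proof (intro ballI impI)
  fix x
  assume x: "x \<in> {x. \<beta> < h x}"
  have "nbhd x \<beta> \<subseteq> {x. \<beta> < h x}"
    using nbhd_height[of _ x \<beta>] x by force
  then show "\<exists>\<gamma><h x. nbhd x \<gamma> \<subseteq> {x. \<beta> < h x}"
    using x by blast
qed

lemma closedin_height_atMost: "closedin space {x. h x \<le> \<beta>}"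
proof -
  have "{x. h x \<le> \<beta>} = topspace space - {x. \<beta> < h x}"
    by auto
  then show ?thesis
    using openin_height_greaterThan by (metis closedin_diff closedin_topspace)
qed

text \<open>Beyond the height of the ladder point with index \<open>m\<close> only blocks with index
  above \<open>m\<close> remain, and no such index is shared by \<open>x\<close> and
  \<open>y\<close>; blocks with different indices are separated by height.\<close>

lemma nbhd_disjoint_same_height:
  assumes "x \<noteq> y" "h x = h y" "limit_ordinal (h x)"
  obtains \<beta> where "\<beta> < h x" "nbhd x \<beta> \<inter> nbhd y \<beta> = {}"
proof -
  obtain m where m: "\<And>n. n \<in> a x \<inter> a y \<Longrightarrow> n < m"
    using almost_disjoint[OF \<open>x \<noteq> y\<close>] unfolding finite_nat_set_iff_bounded by meson
  define \<beta> where "\<beta> = h (p (h x) m)"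
  have \<beta>: "\<beta> < h x"
    using h_less assms by (simp add: \<beta>_def)
  have late: "m < n" if "\<beta> \<le> l (h x) n" for n
  proof (rule ccontr)
    assume "\<not> m < n"
    then have "l (h x) n \<le> l (h x) m"
      using l_mono assms(3) by simp
    then show False
      using that l_less[OF assms(3), of m] by (simp add: \<beta>_def)
  qed
  have "z \<notin> nbhd y \<beta>" if zx: "z \<in> nbhd x \<beta>" for z
  proof
    assume zy: "z \<in> nbhd y \<beta>"
    have "z \<noteq> x" "z \<noteq> y"
      using nbhd_height[OF zy] nbhd_height[OF zx] assms by auto
    then obtain i j where
      i: "i \<in> a x" "\<beta> \<le> l (h x) i" "z \<in> nbhd (p (h x) i) (l (h x) i)" and
      j: "j \<in> a y" "\<beta> \<le> l (h x) j" "z \<in> nbhd (p (h x) j) (l (h x) j)"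
      using nbhd_cases[OF zx] nbhd_cases[OF zy] unfolding \<open>h x = h y\<close> by metis
    have in_block: "l (h x) k < h z \<and> h z \<le> h (p (h x) k)"
      if "z \<in> nbhd (p (h x) k) (l (h x) k)" for k
      using nbhd_height[OF that] l_less[OF assms(3), of k] by auto
    have "\<not> i < j" "\<not> j < i"
      using in_block[OF i(3)] in_block[OF j(3)] h_le_l'[OF assms(3), of i j]
        h_le_l'[OF assms(3), of j i] by auto
    then have "i \<in> a x \<inter> a y"
      using i j by auto
    then show False
      using m[of i] late[OF i(2)] by simp
  qed
  then show thesis
    using that[OF \<beta>] by blast
qed

lemma disjoint_open_nbhds:
  assumes "h x \<le> h y" "x \<noteq> y"
  shows "\<exists>U V. openin space U \<and> openin space V \<and> x \<in> U \<and> y \<in> V \<and> U \<inter> V = {}"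
proof (cases "h x = h y")
  case True
  show ?thesis
  proof (cases "limit_ordinal (h x)")
    case lim: True
    then obtain \<beta> where "\<beta> < h x" "nbhd x \<beta> \<inter> nbhd y \<beta> = {}"
      using nbhd_disjoint_same_height assms True by metis
    then show ?thesis
      using openin_nbhd[of x \<beta>] openin_nbhd[of y \<beta>] nbhd_self True by metis
  next
    case False
    then have "openin space {x}" "openin space {y}"
      using True by (auto simp: openin_space)
    then show ?thesis
      using assms by blast
  qed
next
  case False
  then show ?thesis
    using assms openin_height_atMost[of "h x"] openin_height_greaterThan[of "h x"]
    by (intro exI[of _ "{z. h z \<le> h x}"] exI[of _ "{z. h x < h z}"]) auto
qed

lemma Hausdorff_space: "Hausdorff_space space"
  unfolding Hausdorff_space_def disjnt_def
proof (intro allI impI)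
  fix x y
  assume xy: "x \<in> topspace space \<and> y \<in> topspace space \<and> x \<noteq> y"
  show "\<exists>U V. openin space U \<and> openin space V \<and> x \<in> U \<and> y \<in> V \<and> U \<inter> V = {}"
  proof (cases "h x \<le> h y")
    case True
    then show ?thesis
      using disjoint_open_nbhds xy by blast
  next
    case False
    then have "\<exists>U V. openin space U \<and> openin space V \<and> y \<in> U \<and> x \<in> V \<and> U \<inter> V = {}"
      using disjoint_open_nbhds[of y x] xy by auto
    then show ?thesis
      by (metis inf_commute)
  qed
qed

lemma nbhd_eq:
  "nbhd x \<beta> = insert x (\<Union>n\<in>{n \<in> a x. limit_ordinal (h x) \<and> \<beta> \<le> l (h x) n}.
     nbhd (p (h x) n) (l (h x) n))"
  (is "_ = ?R")
proof
  show "nbhd x \<beta> \<subseteq> ?R"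
    by (auto elim: nbhd_cases)
  show "?R \<subseteq> nbhd x \<beta>"
    using nbhd_self[of x \<beta>] subsetD[OF nbhd_step[of x _ \<beta>]] by auto
qed

lemma countable_nbhd: "countable (nbhd x \<beta>)"
proof (induction "h x" arbitrary: x \<beta> rule: less_induct)
  case less
  have "countable (nbhd (p (h x) n) (l (h x) n))" if "limit_ordinal (h x)" for n
    using less h_less that by blast
  then show ?case
    by (subst nbhd_eq) auto
qed

text \<open>A cover element containing \<open>x\<close> contains all blocks from some bound on. Only
  finitely many blocks remain, and these are compact by induction on the height.\<close>

lemma compactin_nbhd: "limit_ordinal (h x) \<longrightarrow> \<beta> < h x \<Longrightarrow> compactin space (nbhd x \<beta>)"
proof (induction "h x" arbitrary: x \<beta> rule: less_induct)
  case less
  show ?case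
  proof (cases "limit_ordinal (h x)")
    case False
    then show ?thesis
      by (simp add: nbhd_nonlimit compactin_sing)
  next
    case lim: True
    have block: "compactin space (nbhd (p (h x) n) (l (h x) n))" for n
      using less.hyps[of "p (h x) n" "l (h x) n"] h_less[OF lim] l_less[OF lim] by blast
    show ?thesis
      unfolding compactin_def
    proof (intro conjI allI impI)
      fix \<U>
      assume \<U>: "Ball \<U> (openin space) \<and> nbhd x \<beta> \<subseteq> \<Union>\<U>"
      then have open_U: "\<And>U. U \<in> \<U> \<Longrightarrow> openin space U" and cov: "nbhd x \<beta> \<subseteq> \<Union>\<U>"
        by auto
      have "x \<in> \<Union>\<U>"
        using cov nbhd_self[of x \<beta>] by (rule subsetD)
      then obtain U where U: "U \<in> \<U>" "x \<in> U"
        by (rule UnionE)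
      obtain \<beta>' where \<beta>': "\<beta>' < h x" "nbhd x \<beta>' \<subseteq> U"
        using open_nbhdE[OF open_U[OF U(1)] U(2)] lim by metis
      define M where "M = {n \<in> a x. \<beta> \<le> l (h x) n \<and> l (h x) n < \<beta>'}"
      have "finite M"
        by (rule finite_subset[OF _ finite_l_less[OF lim \<beta>'(1)]]) (auto simp: M_def)
      have "\<exists>\<F>. finite \<F> \<and> \<F> \<subseteq> \<U> \<and> nbhd (p (h x) n) (l (h x) n) \<subseteq> \<Union>\<F>" if "n \<in> M" for n
      proof -
        have "nbhd (p (h x) n) (l (h x) n) \<subseteq> \<Union>\<U>"
          using order_trans[OF nbhd_step[OF lim, of n \<beta>] cov] that by (simp add: M_def)
        then show ?thesis
          using block[of n] open_U unfolding compactin_def by meson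
      qed
      then obtain \<F> where \<F>: "\<And>n. n \<in> M \<Longrightarrow>
          finite (\<F> n) \<and> \<F> n \<subseteq> \<U> \<and> nbhd (p (h x) n) (l (h x) n) \<subseteq> \<Union>(\<F> n)"
        by metis
      have "nbhd x \<beta> \<subseteq> \<Union>(insert U (\<Union>n\<in>M. \<F> n))"
      proof
        fix z
        assume z: "z \<in> nbhd x \<beta>"
        show "z \<in> \<Union>(insert U (\<Union>n\<in>M. \<F> n))"
          using z
        proof (cases rule: nbhd_cases)
          case 1
          then show ?thesis
            using U by simp
        next
          case (2 n)
          show ?thesis
          proof (cases "l (h x) n < \<beta>'")
            case True
            then have n: "n \<in> M"
              using 2 by (simp add: M_def)
            then have "z \<in> \<Union>(\<F> n)"
              using \<F>[OF n] 2(4) by (meson subsetD)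
            then show ?thesis
              using n by auto
          next
            case False
            then have "nbhd (p (h x) n) (l (h x) n) \<subseteq> U"
              using nbhd_step[OF lim 2(2), of \<beta>'] \<beta>'(2) by (meson not_less order_trans)
            then show ?thesis
              using 2 by blast
          qed
        qed
      qed
      moreover have "finite (insert U (\<Union>n\<in>M. \<F> n))" "insert U (\<Union>n\<in>M. \<F> n) \<subseteq> \<U>"
        using \<F> \<open>finite M\<close> U by auto
      ultimately show "\<exists>\<F>. finite \<F> \<and> \<F> \<subseteq> \<U> \<and> nbhd x \<beta> \<subseteq> \<Union>\<F>"
        by blast
    qed simp
  qed
qed

lemma exists_small_height: "\<exists>\<beta>. limit_ordinal (h x) \<longrightarrow> \<beta> < h x"
  by (auto simp: limit_ordinal_def)

section \<open>Local properties\<close>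

lemma locally_countable_space: "locally_countable_space space"
  unfolding locally_countable_space_def
proof
  fix x
  obtain \<beta> where "limit_ordinal (h x) \<longrightarrow> \<beta> < h x"
    using exists_small_height by blast
  then show "\<exists>U N. openin space U \<and> x \<in> U \<and> U \<subseteq> N \<and> N \<subseteq> topspace space \<and> countable N"
    using openin_nbhd[of x \<beta>]
    by (intro exI[of _ "nbhd x \<beta>"]) (simp add: nbhd_self countable_nbhd)
qed

lemma locally_compact_space: "locally_compact_space space"
  unfolding locally_compact_space_def
proof
  fix x
  obtain \<beta> where "limit_ordinal (h x) \<longrightarrow> \<beta> < h x"
    using exists_small_height by blast
  then show "\<exists>U K. openin space U \<and> compactin space K \<and> x \<in> U \<and> U \<subseteq> K"
    using openin_nbhd[of x \<beta>] compactin_nbhd[of x \<beta>]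
    by (intro exI[of _ "nbhd x \<beta>"]) (simp add: nbhd_self)
qed

text \<open>Basic open neighbourhoods are compact in a Hausdorff space, hence closed.\<close>

lemma zero_dimensional_space: "zero_dimensional_space space"
  unfolding zero_dimensional_space_def
proof (intro exI[of _ "{nbhd x \<beta> | x \<beta>. limit_ordinal (h x) \<longrightarrow> \<beta> < h x}"] conjI ballI allI impI)
  fix B
  assume "B \<in> {nbhd x \<beta> | x \<beta>. limit_ordinal (h x) \<longrightarrow> \<beta> < h x}"
  then obtain x \<beta> where B: "B = nbhd x \<beta>" "limit_ordinal (h x) \<longrightarrow> \<beta> < h x"
    by blast
  then show "openin space B" "closedin space B"
    using openin_nbhd compactin_imp_closedin[OF Hausdorff_space compactin_nbhd] by blast+
next
  fix U x
  assume "openin space U \<and> x \<in> U"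
  then obtain \<beta> where "limit_ordinal (h x) \<longrightarrow> \<beta> < h x" "nbhd x \<beta> \<subseteq> U"
    using open_nbhdE by metis
  then show "\<exists>B\<in>{nbhd x \<beta> | x \<beta>. limit_ordinal (h x) \<longrightarrow> \<beta> < h x}. x \<in> B \<and> B \<subseteq> U"
    using nbhd_self by blast
qed

section \<open>Closed sets of bounded height\<close>

lemma closed_discrete_level:
  assumes "\<And>x. x \<in> D \<Longrightarrow> h x = \<beta>"
  shows "closed_discrete_in space D"
  unfolding closed_discrete_in_iff
proof (intro conjI ballI)
  fix x
  obtain \<gamma> where \<gamma>: "limit_ordinal (h x) \<longrightarrow> \<gamma> < h x"
    using exists_small_height by blast
  show "\<exists>W. openin space W \<and> x \<in> W \<and> W \<inter> D \<subseteq> {x}"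
  proof (cases "h x = \<beta>")
    case True
    \<comment> \<open>Every other point of the neighbourhood has height below \<beta>.\<close>
    then have "nbhd x \<gamma> \<inter> D \<subseteq> {x}"
      using nbhd_height[of _ x \<gamma>] assms by force
    then show ?thesis
      using openin_nbhd[of x \<gamma>] nbhd_self \<gamma> by blast
  next
    case False
    then consider "h x < \<beta>" | "\<beta> < h x"
      by (meson linorder_neqE)
    then show ?thesis
    proof cases
      case 1
      then show ?thesis
        using openin_height_atMost[of "h x"] assms
        by (intro exI[of _ "{z. h z \<le> h x}"]) (auto simp: not_less[symmetric])
    next
      case 2
      then show ?thesis
        using openin_height_greaterThan[of \<beta>] assms
        by (intro exI[of _ "{z. \<beta> < h z}"]) (auto dest: assms)
    qed
  qed
qed simp

text \<open>The top level \<alpha> is closed discrete and handled directly. What its sets leave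
  uncovered is a closed set \<open>F'\<close> with heights below \<alpha>; it is cut into countably
  many closed bands, each bounded by an ordinal below \<alpha>, to which the induction hypothesis
  applies.\<close>

lemma bounded_closed_D:
  assumes "closedin space F" "\<And>x. x \<in> F \<Longrightarrow> h x \<le> \<alpha>"
    and V: "\<And>x. openin space (V x) \<and> x \<in> V x"
  shows "\<exists>D\<subseteq>F. closed_discrete_in space D \<and> F \<subseteq> \<Union>(V ` D)"
  using assms(1,2)
proof (induction \<alpha> arbitrary: F rule: less_induct)
  case (less \<alpha>)
  define D0 where "D0 = {x \<in> F. h x = \<alpha>}"
  have D0: "closed_discrete_in space D0"
    by (rule closed_discrete_level[of _ \<alpha>]) (simp add: D0_def)
  define F' where "F' = F - \<Union>(V ` D0)"
  have "openin space (\<Union>(V ` D0))"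
    using V by blast
  then have F': "closedin space F'"
    unfolding F'_def using less.prems(1) by (rule closedin_diff[rotated])
  have F'_less: "h x < \<alpha>" if "x \<in> F'" for x
  proof -
    have "x \<in> F" "x \<notin> D0"
      using that V by (auto simp: F'_def)
    then show ?thesis
      using less.prems(2)[of x] by (auto simp: D0_def)
  qed
  define e where "e = from_nat_into {..<\<alpha>}"
  have e_surj: "\<exists>n. e n = \<beta>" if "\<beta> < \<alpha>" for \<beta>
    using from_nat_into_surj[OF countable_lessThan_omega1] that by (auto simp: e_def)
  \<comment> \<open>Band \<open>n\<close> takes the points whose height is first bounded by
    \<open>e n\<close>. The condition \<open>e n < \<alpha>\<close> matters when nothing lies below
    \<alpha>, where the enumeration has unspecified values.\<close>
  define E where "E n = {x \<in> F'. e n < \<alpha> \<and> h x \<le> e n \<and> (\<forall>k<n. e k < h x)}" for n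
  have F'_E: "\<exists>n. x \<in> E n" if x: "x \<in> F'" for x
  proof -
    define n where "n = (LEAST n. h x \<le> e n)"
    obtain m where m: "e m = h x"
      using e_surj[OF F'_less[OF x]] by blast
    have "h x \<le> e n"
      unfolding n_def by (rule LeastI[of "\<lambda>n. h x \<le> e n" m]) (simp add: m)
    moreover have "e k < h x" if "k < n" for k
      using not_less_Least[OF that[unfolded n_def]] by simp
    moreover have "e n < \<alpha>"
    proof -
      have "{..<\<alpha>} \<noteq> {}"
        using F'_less[OF x] by auto
      then show ?thesis
        using from_nat_into[of "{..<\<alpha>}" n] by (simp add: e_def)
    qed
    ultimately show ?thesis
      using x by (auto simp: E_def)
  qed
  have closed_E: "closedin space (E n)" for n
  proof -
    let ?L = "if e n < \<alpha> then {x. h x \<le> e n} else {}"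
    have eq: "E n = F' \<inter> ?L - (\<Union>k\<in>{..<n}. {x. h x \<le> e k})"
      by (auto simp: E_def not_le)
    show ?thesis
      unfolding eq using F' closedin_height_atMost openin_height_atMost
      by (intro closedin_diff closedin_Int openin_Union) auto
  qed
  have "\<exists>D\<subseteq>E n. closed_discrete_in space D \<and> E n \<subseteq> \<Union>(V ` D)" for n
  proof (cases "e n < \<alpha>")
    case True
    show ?thesis
      by (rule less.IH[OF True closed_E]) (simp add: E_def)
  next
    case False
    then have "E n = {}" "closed_discrete_in space {}"
      using closed_discrete_level[of "{}"] by (auto simp: E_def)
    then show ?thesis
      by blast
  qed
  then obtain D where D: "\<And>n. D n \<subseteq> E n \<and> closed_discrete_in space (D n) \<and> E n \<subseteq> \<Union>(V ` D n)"
    by metis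
  \<comment> \<open>The union is locally finite: a point of height below \<alpha> has a
    neighbourhood meeting only bands up to an index of its height, and for the others the complement
    of \<open>F'\<close> meets none.\<close>
  have "closed_discrete_in space (\<Union>n. D n)"
  proof (rule closed_discrete_in_Union)
    fix x
    show "\<exists>W. openin space W \<and> x \<in> W \<and> finite {n \<in> UNIV. D n \<inter> W \<noteq> {}}"
    proof (cases "h x < \<alpha>")
      case True
      then obtain m where m: "e m = h x"
        using e_surj by blast
      have "n \<le> m" if meets: "D n \<inter> {z. h z \<le> h x} \<noteq> {}" for n
      proof (rule ccontr)
        assume "\<not> n \<le> m"
        moreover obtain z where "z \<in> E n" "h z \<le> h x"
          using meets D[of n] by blast
        ultimately show False
          using m by (force simp: E_def not_le)
      qed
      then have "{n \<in> UNIV. D n \<inter> {z. h z \<le> h x} \<noteq> {}} \<subseteq> {..m}"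
        by blast
      then have "finite {n \<in> UNIV. D n \<inter> {z. h z \<le> h x} \<noteq> {}}"
        by (rule finite_subset) simp
      then show ?thesis
        using openin_height_atMost[of "h x"] by (intro exI[of _ "{z. h z \<le> h x}"]) simp
    next
      case False
      have "D n \<inter> (topspace space - F') = {}" for n
        using D[of n] by (auto simp: E_def)
      moreover have "openin space (topspace space - F')"
        using F' by blast
      ultimately show ?thesis
        using False F'_less by (intro exI[of _ "topspace space - F'"]) auto
    qed
  qed (use D in blast)
  then have "closed_discrete_in space (D0 \<union> (\<Union>n. D n))"
    using D0 by (rule closed_discrete_in_Un[rotated])
  moreover have "D0 \<union> (\<Union>n. D n) \<subseteq> F"
    using D by (auto simp: D0_def E_def F'_def)
  moreover have "F \<subseteq> \<Union>(V ` (D0 \<union> (\<Union>n. D n)))"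
  proof
    fix x
    assume x: "x \<in> F"
    show "x \<in> \<Union>(V ` (D0 \<union> (\<Union>n. D n)))"
    proof (cases "x \<in> F'")
      case True
      then obtain n where "x \<in> E n"
        using F'_E by blast
      then have "x \<in> \<Union>(V ` D n)"
        using D[of n] by (meson subsetD)
      then show ?thesis
        by blast
    next
      case False
      then show ?thesis
        using x by (auto simp: F'_def)
    qed
  qed
  ultimately show ?case
    by blast
qed

end

section \<open>Guessing closed sets\<close>

text \<open>Each guess succeeds for club many \<gamma>, and then at all \<open>x\<close> of height
  \<gamma>. The second one speaks of heights because a diamond guess at \<gamma> only sees ordinals
  below \<gamma>: points at or above \<gamma> are described through their heights.\<close>

locale guessing_ladder_space = ladder_space +
  assumes unbounded_fiber: "\<exists>x\<ge>\<gamma>. h x = \<beta>"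
    and guess_set: "(\<And>\<beta>. \<exists>x\<in>Y. \<beta> < h x) \<Longrightarrow>
      \<exists>g. \<forall>\<gamma>. closure_point g \<gamma> \<longrightarrow> (\<forall>x. h x = \<gamma> \<longrightarrow> infinite {n \<in> a x. p \<gamma> n \<in> Y})"
    and guess_levels: "(\<And>\<beta>. \<exists>\<zeta>\<in>Z. \<beta> < \<zeta>) \<Longrightarrow>
      \<exists>g. \<forall>\<gamma>. closure_point g \<gamma> \<longrightarrow>
        (\<forall>x. h x = \<gamma> \<longrightarrow> infinite {n \<in> a x. h (p \<gamma> n) \<in> Z \<and> \<gamma> \<le> p \<gamma> n})"
begin

lemma nbhd_meets:
  assumes "limit_ordinal (h x)" "\<beta> < h x" "infinite {n \<in> a x. Q (p (h x) n)}"
  obtains z where "z \<in> nbhd x \<beta>" "h z < h x" "Q z"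
proof -
  obtain n where "n \<in> {n \<in> a x. Q (p (h x) n)}" "\<beta> \<le> l (h x) n"
    using infinite_l_ge[OF assms] .
  then show thesis
    using nbhd_step[OF assms(1), of n \<beta>] nbhd_self[of "p (h x) n"] h_less[OF assms(1), of n]
      that[of "p (h x) n"] by blast
qed

lemma unbounded_accumulates:
  assumes "\<And>\<beta>. \<exists>x\<in>Y. \<beta> < h x"
  obtains g where "\<And>x U. closure_point g (h x) \<Longrightarrow> openin space U \<Longrightarrow> x \<in> U \<Longrightarrow> U \<inter> Y - {x} \<noteq> {}"
proof -
  obtain g where g: "\<And>\<gamma> x. closure_point g \<gamma> \<Longrightarrow> h x = \<gamma> \<Longrightarrow> infinite {n \<in> a x. p \<gamma> n \<in> Y}"
    using guess_set[OF assms] by blast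
  show thesis
  proof (rule that)
    fix x U
    assume x: "closure_point g (h x)" and U: "openin space U" "x \<in> U"
    have lim: "limit_ordinal (h x)"
      using closure_pointD(1)[OF x] .
    then obtain \<beta> where \<beta>: "\<beta> < h x" "nbhd x \<beta> \<subseteq> U"
      using open_nbhdE[OF U] by blast
    obtain z where "z \<in> nbhd x \<beta>" "h z < h x" "z \<in> Y"
      using nbhd_meets[OF lim \<beta>(1), of "\<lambda>z. z \<in> Y"] g[OF x refl] by blast
    then show "U \<inter> Y - {x} \<noteq> {}"
      using \<beta>(2) by blast
  qed
qed

lemma closed_unbounded_contains_levels:
  assumes F: "closedin space F" and unb: "\<And>\<beta>. \<exists>x\<in>F. \<beta> < h x"
  obtains g where "\<And>x. closure_point g (h x) \<Longrightarrow> x \<in> F"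
proof -
  obtain g where g: "\<And>x U. closure_point g (h x) \<Longrightarrow> openin space U \<Longrightarrow> x \<in> U \<Longrightarrow> U \<inter> F - {x} \<noteq> {}"
    using unbounded_accumulates[OF unb] by blast
  have "openin space (topspace space - F)"
    using F by blast
  then have "x \<in> F" if "closure_point g (h x)" for x
    using g[OF that, of "topspace space - F"] by auto
  then show thesis
    using that by blast
qed

text \<open>\<open>F\<close> contains whole levels for club many heights, so membership in
  \<open>F\<close> can be ensured by the height alone. Guessing this set of heights finds ladder
  points that lie in \<open>F\<close> although they are at or above \<open>h x\<close> as
  ordinals.\<close>

lemma closed_unbounded_late_points:
  assumes F: "closedin space F" and unb: "\<And>\<beta>. \<exists>x\<in>F. \<beta> < h x"
  obtains g where "\<And>x. closure_point g (h x) \<Longrightarrow> x \<in> F"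
    "\<And>x U. closure_point g (h x) \<Longrightarrow> openin space U \<Longrightarrow> x \<in> U \<Longrightarrow>
      \<exists>z\<in>F \<inter> U. h z < h x \<and> h x \<le> z"
proof -
  obtain f where f: "\<And>x. closure_point f (h x) \<Longrightarrow> x \<in> F"
    using closed_unbounded_contains_levels[OF assms] by blast
  have "\<exists>\<zeta>\<in>Collect (closure_point f). \<beta> < \<zeta>" for \<beta>
    using exists_closure_point[of \<beta> f] by blast
  then obtain g where g: "\<And>\<gamma> x. closure_point g \<gamma> \<Longrightarrow> h x = \<gamma> \<Longrightarrow>
      infinite {n \<in> a x. h (p \<gamma> n) \<in> Collect (closure_point f) \<and> \<gamma> \<le> p \<gamma> n}"
    using guess_levels[of "Collect (closure_point f)"] by blast
  show thesis
  proof (rule that[of "\<lambda>\<xi>. max (f \<xi>) (g \<xi>)"])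
    fix x
    assume x: "closure_point (\<lambda>\<xi>. max (f \<xi>) (g \<xi>)) (h x)"
    have xf: "closure_point f (h x)" and xg: "closure_point g (h x)"
      by (rule closure_point_mono[OF x], simp)+
    show "x \<in> F"
      using f[OF xf] .
    fix U
    assume U: "openin space U" "x \<in> U"
    have lim: "limit_ordinal (h x)"
      using closure_pointD(1)[OF x] .
    then obtain \<beta> where \<beta>: "\<beta> < h x" "nbhd x \<beta> \<subseteq> U"
      using open_nbhdE[OF U] by blast
    obtain z where "z \<in> nbhd x \<beta>" "h z < h x" "h z \<in> Collect (closure_point f) \<and> h x \<le> z"
      using nbhd_meets[OF lim \<beta>(1), of "\<lambda>z. h z \<in> Collect (closure_point f) \<and> h x \<le> z"]
        g[OF xg refl] by blast
    then show "\<exists>z\<in>F \<inter> U. h z < h x \<and> h x \<le> z"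
      using \<beta>(2) f[of z] by blast
  qed
qed

section \<open>Failure of linear D\<close>

lemma closed_discrete_bounded:
  assumes D: "closed_discrete_in space D"
  obtains \<beta> where "\<And>x. x \<in> D \<Longrightarrow> h x \<le> \<beta>"
proof (rule ccontr)
  assume "\<not> thesis"
  then have unb: "\<exists>x\<in>D. \<beta> < h x" for \<beta>
    using that[of \<beta>] by (meson not_less)
  then obtain g where
    g: "\<And>x U. closure_point g (h x) \<Longrightarrow> openin space U \<Longrightarrow> x \<in> U \<Longrightarrow> U \<inter> D - {x} \<noteq> {}"
    using unbounded_accumulates[OF unb] by blast
  obtain \<gamma> where "closure_point g \<gamma>"
    using exists_closure_point by blast
  moreover obtain x where "h x = \<gamma>"
    using unbounded_fiber by blast
  moreover obtain W where "openin space W" "x \<in> W" "W \<inter> D \<subseteq> {x}"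
    using D unfolding closed_discrete_in_iff by auto
  ultimately show False
    using g[of x W] by blast
qed

lemma not_linearly_D: "\<not> linearly_D_space space"
proof
  assume "linearly_D_space space"
  moreover have "open_nbhd_assignment space (\<lambda>x. {z. h z \<le> h x})"
    using openin_height_atMost by (simp add: open_nbhd_assignment_def)
  moreover have "chain\<^sub>\<subseteq> (range (\<lambda>x. {z. h z \<le> h x}))"
    by (auto simp: chain_subset_def)
  ultimately obtain D where D: "closed_discrete_in space D" "UNIV = (\<Union>x\<in>D. {z. h z \<le> h x})"
    unfolding linearly_D_space_def topspace_space by meson
  obtain \<beta> where \<beta>: "\<And>x. x \<in> D \<Longrightarrow> h x \<le> \<beta>"
    using closed_discrete_bounded[OF D(1)] by blast
  obtain \<gamma> where "\<beta> < \<gamma>"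
    using exists_closure_point by blast
  obtain z where "h z = \<gamma>"
    using unbounded_fiber by blast
  then obtain x where "x \<in> D" "\<gamma> \<le> h x"
    using D(2) by blast
  then show False
    using \<beta>[of x] \<open>\<beta> < \<gamma>\<close> by simp
qed

section \<open>The aD-property\<close>

text \<open>
  The pressing-down argument: each chosen point \<open>z \<gamma>\<close> has height below \<open>\<gamma>\<close>, so for stationarily many
  \<open>\<gamma>\<close> the height is one and the same \<open>\<beta>\<close>; since \<open>\<gamma> \<le> z \<gamma>\<close>, these points can still be taken distinct.
  A closed set that meets no level of a stationary set of heights is bounded.
\<close>

lemma unbounded_closed_reduction:
  assumes F: "closedin space F" and unb: "\<And>\<beta>. \<exists>x\<in>F. \<beta> < h x"
    and V: "\<And>x. openin space (V x) \<and> x \<in> V x"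
  obtains A \<psi> \<beta> where "A \<subseteq> F" "closed_discrete_in space A" "\<And>z. z \<in> A \<Longrightarrow> z \<in> V (\<psi> z)"
    "\<And>x. x \<in> F - (\<Union>z\<in>A. V (\<psi> z)) \<Longrightarrow> h x \<le> \<beta>"
proof -
  obtain g where g_F: "\<And>x. closure_point g (h x) \<Longrightarrow> x \<in> F"
    and g_late: "\<And>x U. closure_point g (h x) \<Longrightarrow> openin space U \<Longrightarrow> x \<in> U \<Longrightarrow>
      \<exists>z\<in>F \<inter> U. h z < h x \<and> h x \<le> z"
    using closed_unbounded_late_points[OF F unb] by blast
  \<comment> \<open>One point \<open>y \<gamma>\<close> represents level \<gamma>;
    \<open>z \<gamma>\<close> will be a late point of \<open>F\<close> in the set assigned to
    \<open>y \<gamma>\<close>.\<close>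
  obtain y where y: "\<And>\<gamma>. h (y \<gamma>) = \<gamma>"
    using unbounded_fiber by metis
  have "\<exists>z. closure_point g \<gamma> \<longrightarrow> z \<in> F \<and> z \<in> V (y \<gamma>) \<and> h z < \<gamma> \<and> \<gamma> \<le> z" for \<gamma>
    using g_late[of "y \<gamma>" "V (y \<gamma>)"] V[of "y \<gamma>"] y[of \<gamma>] by auto
  then obtain z where z: "\<And>\<gamma>. closure_point g \<gamma> \<Longrightarrow> z \<gamma> \<in> F \<and> z \<gamma> \<in> V (y \<gamma>) \<and> h (z \<gamma>) < \<gamma> \<and> \<gamma> \<le> z \<gamma>"
    by metis
  \<comment> \<open>The last condition separates the chosen points: for \<delta> < \<gamma> in
    \<open>S \<beta>\<close> it gives \<open>z \<delta> < \<gamma> \<le> z \<gamma>\<close>.\<close>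
  define S where "S \<beta> = {\<gamma>. closure_point g \<gamma> \<and> h (z \<gamma>) = \<beta> \<and> (\<forall>\<delta><\<gamma>. z \<delta> < \<gamma>)}" for \<beta>
  define R where "R \<beta> = F - (\<Union>\<gamma>\<in>S \<beta>. V (y \<gamma>))" for \<beta>
  have closed_R: "closedin space (R \<beta>)" for \<beta>
    unfolding R_def using F V by (intro closedin_diff openin_Union) auto
  \<comment> \<open>Otherwise every \<open>R \<beta>\<close> contains whole levels for club many
    heights. A height \<gamma> in the diagonal intersection of these clubs has
    \<open>y \<gamma>\<close> in \<open>R \<beta>\<close> for
    \<open>\<beta> = h (z \<gamma>) < \<gamma>\<close>, yet \<open>V (y \<gamma>)\<close> was
    removed there.\<close>
  have "\<exists>\<beta> \<alpha>. \<forall>x\<in>R \<beta>. h x \<le> \<alpha>"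
  proof (rule ccontr)
    assume "\<nexists>\<beta> \<alpha>. \<forall>x\<in>R \<beta>. h x \<le> \<alpha>"
    then have "\<exists>x\<in>R \<beta>. \<alpha> < h x" for \<alpha> \<beta>
      by (meson not_less)
    then have "\<exists>f. \<forall>x. closure_point f (h x) \<longrightarrow> x \<in> R \<beta>" for \<beta>
      using closed_unbounded_contains_levels[OF closed_R[of \<beta>]] by metis
    then obtain f where f: "\<And>\<beta> x. closure_point (f \<beta>) (h x) \<Longrightarrow> x \<in> R \<beta>"
      by metis
    obtain k where k: "\<And>\<beta> \<xi> \<gamma>. \<beta> \<le> \<gamma> \<Longrightarrow> \<xi> \<le> \<gamma> \<Longrightarrow> f \<beta> \<xi> < k \<gamma>"
      using common_bound_omega1 by blast
    \<comment> \<open>Besides the diagonal intersection given by \<open>k\<close>, closure under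
      \<open>g\<close> makes \<open>z \<gamma>\<close> meaningful, and closure under
      \<open>z\<close> gives the separation required in \<open>S \<beta>\<close>.\<close>
    obtain \<gamma> where \<gamma>: "closure_point (\<lambda>\<xi>. max (k \<xi>) (max (g \<xi>) (z \<xi>))) \<gamma>"
      using exists_closure_point by blast
    have k_\<gamma>: "closure_point k \<gamma>" and g_\<gamma>: "closure_point g \<gamma>" and z_\<gamma>: "closure_point z \<gamma>"
      by (rule closure_point_mono[OF \<gamma>], simp add: le_max_iff_disj)+
    define \<beta> where "\<beta> = h (z \<gamma>)"
    have "\<beta> < \<gamma>"
      using z[OF g_\<gamma>] by (simp add: \<beta>_def)
    have "f \<beta> \<xi> < \<gamma>" if "\<xi> < \<gamma>" for \<xi>
      using k[of \<beta> "max \<beta> \<xi>" \<xi>] closure_pointD(2)[OF k_\<gamma>, of "max \<beta> \<xi>"] that \<open>\<beta> < \<gamma>\<close> by auto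
    then have "closure_point (f \<beta>) \<gamma>"
      using closure_pointD(1)[OF g_\<gamma>] by (simp add: closure_point_def)
    then have "y \<gamma> \<in> R \<beta>"
      using f[of \<beta> "y \<gamma>"] y by simp
    moreover have "\<gamma> \<in> S \<beta>"
      using g_\<gamma> closure_pointD(2)[OF z_\<gamma>] by (simp add: S_def \<beta>_def)
    ultimately show False
      using V[of "y \<gamma>"] by (auto simp: R_def)
  qed
  then obtain \<beta> \<alpha> where \<beta>: "\<And>x. x \<in> R \<beta> \<Longrightarrow> h x \<le> \<alpha>"
    by blast
  \<comment> \<open>By injectivity \<open>\<psi>\<close> can recover \<gamma>, and with it
    \<open>y \<gamma>\<close>, from the point \<open>z \<gamma>\<close>.\<close>
  have "inj_on z (S \<beta>)"
  proof (rule linorder_inj_onI)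
    fix \<gamma> \<delta>
    assume "\<gamma> < \<delta>" "\<gamma> \<in> S \<beta>" "\<delta> \<in> S \<beta>"
    then have "z \<gamma> < \<delta>" "\<delta> \<le> z \<delta>"
      using z[of \<delta>] by (auto simp: S_def)
    then show "z \<gamma> \<noteq> z \<delta>"
      by auto
  qed auto
  then have inv: "inv_into (S \<beta>) z (z \<gamma>) = \<gamma>" if "\<gamma> \<in> S \<beta>" for \<gamma>
    using that by simp
  show thesis
  proof (rule that[of "z ` S \<beta>" "\<lambda>x. y (inv_into (S \<beta>) z x)" \<alpha>])
    show "z ` S \<beta> \<subseteq> F"
      using z by (auto simp: S_def)
    show "closed_discrete_in space (z ` S \<beta>)"
      by (rule closed_discrete_level[of _ \<beta>]) (auto simp: S_def)
    show "x \<in> V (y (inv_into (S \<beta>) z x))" if "x \<in> z ` S \<beta>" for x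
      using that z inv by (auto simp: S_def)
    show "h x \<le> \<alpha>" if "x \<in> F - (\<Union>x\<in>z ` S \<beta>. V (y (inv_into (S \<beta>) z x)))" for x
      using that inv by (intro \<beta>) (simp add: R_def)
  qed
qed

text \<open>A first closed discrete set \<open>A\<close> reduces \<open>F\<close> to a closed
  remainder of bounded height, which a second one covers. A point \<open>z\<close> of
  \<open>A\<close> uses the cover element chosen for a possibly different point
  \<open>\<psi> z\<close>, which the aD-property permits.\<close>

lemma aD_space: "aD_space space"
  unfolding aD_space_def
proof (intro allI impI)
  fix F \<U>
  assume "closedin space F \<and> open_cover_of space \<U>"
  then have F: "closedin space F" and \<U>: "\<And>U. U \<in> \<U> \<Longrightarrow> openin space U" "\<Union>\<U> = UNIV"
    by (auto simp: open_cover_of_def)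
  have "\<exists>U. U \<in> \<U> \<and> x \<in> U" for x
    using UnionE[of x \<U>] \<U>(2) by auto
  then obtain V where V: "\<And>x. V x \<in> \<U> \<and> x \<in> V x"
    by metis
  then have V_open: "\<And>x. openin space (V x) \<and> x \<in> V x"
    using \<U>(1) by blast
  have "\<exists>A \<psi> \<beta>. A \<subseteq> F \<and> closed_discrete_in space A \<and> (\<forall>z\<in>A. z \<in> V (\<psi> z)) \<and>
      (\<forall>x\<in>F - (\<Union>z\<in>A. V (\<psi> z)). h x \<le> \<beta>)"
  proof (cases "\<exists>\<beta>. \<forall>x\<in>F. h x \<le> \<beta>")
    case True
    then show ?thesis
      using closed_discrete_level[of "{}"] by (intro exI[of _ "{}"]) auto
  next
    case False
    then have unb: "\<exists>x\<in>F. \<beta> < h x" for \<beta>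
      by (meson not_less)
    show ?thesis
      by (rule unbounded_closed_reduction[OF F unb V_open]) blast
  qed
  then obtain A \<psi> \<beta> where A: "A \<subseteq> F" "closed_discrete_in space A" "\<forall>z\<in>A. z \<in> V (\<psi> z)"
    and \<beta>: "\<forall>x\<in>F - (\<Union>z\<in>A. V (\<psi> z)). h x \<le> \<beta>"
    by blast
  define R where "R = F - (\<Union>z\<in>A. V (\<psi> z))"
  have "closedin space R"
    unfolding R_def using F V_open by (intro closedin_diff openin_Union) auto
  then obtain D where D: "D \<subseteq> R" "closed_discrete_in space D" "R \<subseteq> \<Union>(V ` D)"
    using bounded_closed_D[of R \<beta> V] \<beta> V_open unfolding R_def by meson
  \<comment> \<open>Points of \<open>A\<close> lie in the removed sets, hence not in
    \<open>D\<close>, so \<open>\<phi>\<close> agrees with \<open>V\<close> on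
    \<open>D\<close>.\<close>
  have disj: "D \<inter> A = {}"
    using D(1) A(3) by (auto simp: R_def)
  define \<phi> where "\<phi> x = (if x \<in> A then V (\<psi> x) else V x)" for x
  show "\<exists>A \<phi>. A \<subseteq> F \<and> closed_discrete_in space A \<and> (\<forall>a\<in>A. \<phi> a \<in> \<U> \<and> a \<in> \<phi> a) \<and>
      F \<subseteq> \<Union>(\<phi> ` A)"
  proof (intro exI[of _ "A \<union> D"] exI[of _ \<phi>] conjI ballI)
    show "A \<union> D \<subseteq> F"
      using A(1) D(1) by (auto simp: R_def)
    show "closed_discrete_in space (A \<union> D)"
      using A(2) D(2) by (rule closed_discrete_in_Un)
    show "\<phi> x \<in> \<U>" "x \<in> \<phi> x" if "x \<in> A \<union> D" for x
      using V A(3) by (auto simp: \<phi>_def)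
    have "\<phi> ` A = (\<lambda>z. V (\<psi> z)) ` A" "\<phi> ` D = V ` D"
      using disj by (auto simp: \<phi>_def intro!: image_cong)
    then show "F \<subseteq> \<Union>(\<phi> ` (A \<union> D))"
      using D(3) by (auto simp: R_def image_Un)
  qed
qed

end

section \<open>Ladders from the diamond sequence\<close>

lemma diamond_star_guessing:
  assumes "diamond_star"
  obtains \<A> :: "omega1 \<Rightarrow> omega1 set set" where
    "\<And>\<alpha>. limit_ordinal \<alpha> \<Longrightarrow> countable (\<A> \<alpha>)"
    "\<And>Y. \<exists>g. \<forall>\<gamma>. closure_point g \<gamma> \<longrightarrow> Y \<inter> {..<\<gamma>} \<in> \<A> \<gamma>"
proof -
  obtain \<A> :: "omega1 \<Rightarrow> omega1 set set" where \<A>: "\<And>\<alpha>. limit_ordinal \<alpha> \<Longrightarrow> countable (\<A> \<alpha>)"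
    "\<And>Y. \<exists>C. club C \<and> (\<forall>\<alpha>\<in>C. limit_ordinal \<alpha> \<longrightarrow> Y \<inter> {..<\<alpha>} \<in> \<A> \<alpha>)"
    using assms unfolding diamond_star_def by metis
  have "\<exists>g. \<forall>\<gamma>. closure_point g \<gamma> \<longrightarrow> Y \<inter> {..<\<gamma>} \<in> \<A> \<gamma>" for Y
  proof -
    obtain C where "club C" "\<And>\<alpha>. \<alpha> \<in> C \<Longrightarrow> limit_ordinal \<alpha> \<Longrightarrow> Y \<inter> {..<\<alpha>} \<in> \<A> \<alpha>"
      using \<A>(2) by blast
    moreover obtain g where "\<And>\<gamma>. closure_point g \<gamma> \<Longrightarrow> \<gamma> \<in> C"
      using club_closure_points[OF \<open>club C\<close>] by blast
    ultimately show ?thesis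
      using closure_pointD(1) by blast
  qed
  with \<A>(1) show thesis
    using that by blast
qed

lemma exists_guessing_ladder_space:
  assumes "diamond_star"
  obtains h a l p where "guessing_ladder_space h a l p"
proof -
  obtain \<A> :: "omega1 \<Rightarrow> omega1 set set" where
    \<A>_countable: "\<And>\<alpha>. limit_ordinal \<alpha> \<Longrightarrow> countable (\<A> \<alpha>)" and
    \<A>_guess: "\<And>Y. \<exists>g. \<forall>\<gamma>. closure_point g \<gamma> \<longrightarrow> Y \<inter> {..<\<gamma>} \<in> \<A> \<gamma>"
    using diamond_star_guessing[OF assms] by blast
  obtain h :: "omega1 \<Rightarrow> omega1" where h: "\<And>\<beta> \<gamma>. \<exists>x\<ge>\<gamma>. h x = \<beta>"
    using exists_unbounded_fibers by blast
  obtain a :: "omega1 \<Rightarrow> nat set" where a: "\<And>x y. x \<noteq> y \<Longrightarrow> finite (a x \<inter> a y)"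
    "\<And>x i. infinite {n \<in> a x. fst (prod_decode n) = i}"
    using exists_almost_disjoint_family by blast
  \<comment> \<open>Candidates are the guessed sets and the sets of points at or above \<gamma> with
    heights in a guessed set; those with heights cofinal in \<gamma> can supply a ladder.
    \<open>UNIV\<close> ensures that the family is nonempty.\<close>
  define \<P> where "\<P> \<gamma> = {P \<in> insert UNIV (\<A> \<gamma> \<union> (\<lambda>Z. {x. h x \<in> Z \<and> \<gamma> \<le> x}) ` \<A> \<gamma>).
    \<forall>\<beta><\<gamma>. \<exists>x\<in>P. \<beta> < h x \<and> h x < \<gamma>}" for \<gamma>
  have \<P>_countable: "countable (\<P> \<gamma>)" if "limit_ordinal \<gamma>" for \<gamma>
  proof (rule countable_subset)
    show "\<P> \<gamma> \<subseteq> insert UNIV (\<A> \<gamma> \<union> (\<lambda>Z. {x. h x \<in> Z \<and> \<gamma> \<le> x}) ` \<A> \<gamma>)"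
      by (auto simp: \<P>_def)
  qed (use \<A>_countable[OF that] in auto)
  have \<P>_nonempty: "\<P> \<gamma> \<noteq> {}" if "limit_ordinal \<gamma>" for \<gamma>
  proof -
    have "\<exists>x\<in>UNIV. \<beta> < h x \<and> h x < \<gamma>" if "\<beta> < \<gamma>" for \<beta>
      using h \<open>limit_ordinal \<gamma>\<close> that unfolding limit_ordinal_def by (metis UNIV_I)
    then have "UNIV \<in> \<P> \<gamma>"
      by (simp add: \<P>_def)
    then show ?thesis
      by blast
  qed
  \<comment> \<open>The column of an index \<open>n\<close> determines the candidate used there. As
    each \<open>a x\<close> meets every column in an infinite set, each candidate recurs infinitely
    often along each \<open>a x\<close>.\<close>
  define P where "P \<gamma> n = from_nat_into (\<P> \<gamma>) (fst (prod_decode n))" for \<gamma> n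
  have P_infinite: "infinite {n \<in> a x. P \<gamma> n = Q}" if lim: "limit_ordinal \<gamma>" and "Q \<in> \<P> \<gamma>" for \<gamma> x Q
  proof -
    obtain i where i: "from_nat_into (\<P> \<gamma>) i = Q"
      using from_nat_into_surj[OF \<P>_countable[OF lim] \<open>Q \<in> \<P> \<gamma>\<close>] by blast
    have "{n \<in> a x. fst (prod_decode n) = i} \<subseteq> {n \<in> a x. P \<gamma> n = Q}"
      using i by (auto simp: P_def)
    then show ?thesis
      using a(2) finite_subset by blast
  qed
  have "\<exists>l p. (\<forall>n. p n \<in> P \<gamma> n \<and> l n < h (p n) \<and> h (p n) \<le> l (Suc n) \<and> h (p n) < \<gamma>) \<and>
      (\<forall>\<beta><\<gamma>. \<exists>n. \<beta> \<le> l n)" if lim: "limit_ordinal \<gamma>" for \<gamma>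
  proof -
    have "\<exists>x\<in>P \<gamma> n. \<beta> < h x \<and> h x < \<gamma>" if "\<beta> < \<gamma>" for n \<beta>
      using from_nat_into[OF \<P>_nonempty[OF lim], of "fst (prod_decode n)"] that
      by (simp add: P_def \<P>_def)
    then obtain l p where "\<And>n. p n \<in> P \<gamma> n" "\<And>n. l n < h (p n)" "\<And>n. h (p n) \<le> l (Suc n)"
      "\<And>n. h (p n) < \<gamma>" "\<And>\<beta>. \<beta> < \<gamma> \<Longrightarrow> \<exists>n. \<beta> \<le> l n"
      using exists_ladder[OF lim, of "P \<gamma>" h] by metis
    then show ?thesis
      by (intro exI[of _ l] exI[of _ p]) auto
  qed
  then obtain l p where p: "\<And>\<gamma> n. limit_ordinal \<gamma> \<Longrightarrow> p \<gamma> n \<in> P \<gamma> n"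
    and ladder: "\<And>\<gamma> n. limit_ordinal \<gamma> \<Longrightarrow> l \<gamma> n < h (p \<gamma> n)"
      "\<And>\<gamma> n. limit_ordinal \<gamma> \<Longrightarrow> h (p \<gamma> n) \<le> l \<gamma> (Suc n)"
      "\<And>\<gamma> n. limit_ordinal \<gamma> \<Longrightarrow> h (p \<gamma> n) < \<gamma>"
      "\<And>\<gamma> \<beta>. limit_ordinal \<gamma> \<Longrightarrow> \<beta> < \<gamma> \<Longrightarrow> \<exists>n. \<beta> \<le> l \<gamma> n"
    by metis
  have p_infinite: "infinite {n \<in> a x. p \<gamma> n \<in> Q}" if lim: "limit_ordinal \<gamma>" and Q: "Q \<in> \<P> \<gamma>" for \<gamma> x Q
  proof -
    have "{n \<in> a x. P \<gamma> n = Q} \<subseteq> {n \<in> a x. p \<gamma> n \<in> Q}"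
      using p[OF lim] by auto
    then show ?thesis
      using P_infinite[OF lim Q] finite_subset by blast
  qed
  have "guessing_ladder_space h a l p"
  proof unfold_locales
    fix Y
    assume "\<And>\<beta>. \<exists>x\<in>Y. \<beta> < h x"
    then obtain f where f: "\<And>\<beta>. f \<beta> \<in> Y" "\<And>\<beta>. \<beta> < h (f \<beta>)"
      by metis
    obtain g where g: "\<And>\<gamma>. closure_point g \<gamma> \<Longrightarrow> Y \<inter> {..<\<gamma>} \<in> \<A> \<gamma>"
      using \<A>_guess by blast
    \<comment> \<open>Closure under \<open>f\<close> and \<open>h (f \<xi>)\<close> puts
      \<open>f \<beta>\<close> into \<open>Y\<close> below \<gamma>, with height between \<beta> and
      \<gamma>, so \<open>Y \<inter> {..<\<gamma>}\<close> is a candidate at \<gamma>.\<close>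
    have "infinite {n \<in> a x. p \<gamma> n \<in> Y}"
      if \<gamma>: "closure_point (\<lambda>\<xi>. max (g \<xi>) (max (f \<xi>) (h (f \<xi>)))) \<gamma>" for \<gamma> x
    proof -
      have lim: "limit_ordinal \<gamma>"
        using closure_pointD(1)[OF \<gamma>] .
      have g_\<gamma>: "closure_point g \<gamma>"
        by (rule closure_point_mono[OF \<gamma>]) simp
      have "\<exists>x\<in>Y \<inter> {..<\<gamma>}. \<beta> < h x \<and> h x < \<gamma>" if "\<beta> < \<gamma>" for \<beta>
        using closure_pointD(2)[OF \<gamma> that] f[of \<beta>] by (intro bexI[of _ "f \<beta>"]) auto
      then have "Y \<inter> {..<\<gamma>} \<in> \<P> \<gamma>"
        using g[OF g_\<gamma>] by (simp add: \<P>_def)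
      from p_infinite[OF lim this] show ?thesis
        by (rule contrapos_nn) (auto elim: rev_finite_subset)
    qed
    then show "\<exists>g. \<forall>\<gamma>. closure_point g \<gamma> \<longrightarrow> (\<forall>x. h x = \<gamma> \<longrightarrow> infinite {n \<in> a x. p \<gamma> n \<in> Y})"
      by blast
  next
    fix Z :: "omega1 set"
    assume "\<And>\<beta>. \<exists>\<zeta>\<in>Z. \<beta> < \<zeta>"
    then obtain f where f: "\<And>\<beta>. f \<beta> \<in> Z" "\<And>\<beta>. \<beta> < f \<beta>"
      by metis
    obtain g where g: "\<And>\<gamma>. closure_point g \<gamma> \<Longrightarrow> Z \<inter> {..<\<gamma>} \<in> \<A> \<gamma>"
      using \<A>_guess by blast
    \<comment> \<open>Closure under \<open>f\<close> makes \<open>Z\<close> cofinal in \<gamma>, and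
      unbounded fibres supply points at or above \<gamma> of each such height; so \<open>?Q\<close>,
      built from the guessed part of \<open>Z\<close>, is a candidate at \<gamma>.\<close>
    have "infinite {n \<in> a x. h (p \<gamma> n) \<in> Z \<and> \<gamma> \<le> p \<gamma> n}"
      if \<gamma>: "closure_point (\<lambda>\<xi>. max (g \<xi>) (f \<xi>)) \<gamma>" for \<gamma> x
    proof -
      let ?Q = "{x. h x \<in> Z \<inter> {..<\<gamma>} \<and> \<gamma> \<le> x}"
      have lim: "limit_ordinal \<gamma>"
        using closure_pointD(1)[OF \<gamma>] .
      have g_\<gamma>: "closure_point g \<gamma>"
        by (rule closure_point_mono[OF \<gamma>]) simp
      have "\<exists>x\<in>?Q. \<beta> < h x \<and> h x < \<gamma>" if "\<beta> < \<gamma>" for \<beta>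
      proof -
        obtain x where "\<gamma> \<le> x" "h x = f \<beta>"
          using h by blast
        then show ?thesis
          using closure_pointD(2)[OF \<gamma> that] f[of \<beta>] by (intro bexI[of _ x]) auto
      qed
      then have "?Q \<in> \<P> \<gamma>"
        unfolding \<P>_def using g[OF g_\<gamma>] by blast
      from p_infinite[OF lim this] show ?thesis
        by (rule contrapos_nn) (auto elim: rev_finite_subset)
    qed
    then show "\<exists>g. \<forall>\<gamma>. closure_point g \<gamma> \<longrightarrow>
        (\<forall>x. h x = \<gamma> \<longrightarrow> infinite {n \<in> a x. h (p \<gamma> n) \<in> Z \<and> \<gamma> \<le> p \<gamma> n})"
      by blast
  qed (use a(1) ladder h in auto)
  then show thesis
    using that by blast
qed

theorem theorem5p2:
  assumes "diamond_star"
  shows "\<exists>X :: omega1 topology.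
           locally_countable_space X \<and> locally_compact_space X \<and>
           zero_dimensional_space X \<and> Hausdorff_space X \<and>
           topspace X \<approx> (UNIV :: omega1 set) \<and>
           \<not> linearly_D_space X \<and>
           (\<forall>F. closedin X F \<longrightarrow> irreducible_space (subtopology X F)) \<and>
           aD_space X"
proof -
  obtain h a l p where "guessing_ladder_space h a l p"
    using exists_guessing_ladder_space[OF assms] by blast
  then interpret guessing_ladder_space h a l p .
  show ?thesis
    using locally_countable_space locally_compact_space zero_dimensional_space Hausdorff_space
      not_linearly_D aD_space irreducible_closed_subspace[OF aD_space]
    by (intro exI[of _ space]) simp
qed

end
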